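(* Let $p$ be an odd prime. Then the following are equivalent. (1) The prime $2$ is a primitive root mod $p$. (2) $|(\mathbb{F}_2 C_p)^\times| = 2^{p-1}-1$. (3) The only units in $\mathbb{F}_2 C_p$ which have order $p$ are the non-identity elements of $C_p$. (4) If $\theta$ is an element of $\mathbb{F}_2 C_p$ which is not the norm element and which is not in the kernel of the augmentation map, then $\theta$ is a unit. (5) There are $2^{p-1}-1$ invertible circulant matrices of size $p \times p$ over $\mathbb{F}_2$. (6) The only invertible $p\times p$ circulant matrices over $\mathbb{F}_2$ that have order dividing $p$ are the circulant permutation matrices. (7) If $A$ is a $p \times p$ circulant matrix over $\mathbb{F}_2$ which is not $J$ (the $p\times p$ matrix with all entries $1$) and the vector of all $1$'s is not in the null space of $A$, then $A$ is invertible over $\mathbb{F}_2$. (8) There are $2^{p-1}-1$ circulant $(p,p)$ bipartite graphs on labeled vertices with an odd number of perfect matchings. (9) If $G$ is a circulant $(p,p)$ bipartite graph on labeled vertices with odd degree and $G$ is not a complete bipartite graph, then $G$ has an odd number of perfect matchings. (10) If $G$ is a circulant $(p,p)$ bipartite graph on labeled vertices with an odd number of perfect matchings and $s_{ij}(p) \bmod 2 = \delta_{ij}$ for all $1\le i,j\le p$, then the degree of $G$ is $1$. Moreover, if any of these statements hold, then $p \equiv 3$ or $5 \pmod 8$.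
   Context: $2$ is a primitive root mod $p$ if $2$ generates the multiplicative group of the field with $p$ elements. $C_p$ is the multiplicative cyclic group of order $p$, $\mathbb{F}_2C_p$ its group algebra over $\mathbb{F}_2$, and $R^\times$ the group of units of a ring $R$. The norm element of $\mathbb{F}_2C_p$ is the sum of all elements of $C_p$; the augmentation map $\mathbb{F}_2C_p\to\mathbb{F}_2$ sends an element to the sum of its coefficients. Orders are multiplicative orders. An $n\times n$ matrix over a field is circulant if each column is obtained from the preceding column by rotating it cyclically one entry down. A circulant permutation matrix is a circulant matrix that is a permutation matrix. An $(n,n)$ bipartite graph is a bipartite graph on labeled vertex sets $A=\{a_1,\dots,a_n\}$ and $B=\{b_1,\dots,b_n\}$. Its biadjacency matrix is the $n\times n$ binary matrix $M=(m_{ij})$ with $m_{ij}=1$ if and only if $a_i$ is adjacent to $b_j$. The graph is circulant if its biadjacency matrix is circulant; such a graph is regular, and its degree is the common degree of its vertices. A perfect matching is a set of edges such that every vertex is incident to exactly one of them. A pseudopath of length $r$ is an ordered sequence $e_1,\dots,e_r$ of edges (repetitions allowed), each regarded as going from its endpoint in $A$ (head) to its endpoint in $B$ (tail), such that for all $1\le i\le r-1$ the endpoint of $e_i$ in $B$ and the endpoint of $e_{i+1}$ in $A$ have the same subscript. It is between $a_i$ and $b_j$ if $e_1$ starts at $a_i$ and $e_r$ ends at $b_j$. $s_{ij}(r)$ is the number of pseudopaths of length $r$ between $a_i$ and $b_j$ (equivalently, the $(i,j)$ entry of the integer matrix $M^r$). $\delta_{ij}$ is the Kronecker delta. *)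

theory Defs
  imports
    "HOL-Library.Z2"
    "HOL-Algebra.Elementary_Groups"
    "HOL-Algebra.Multiplicative_Group"
    "HOL-Number_Theory.Residues"
    "HOL-Combinatorics.Permutations"
    "Jordan_Normal_Form.Matrix_Kernel"
begin

definition all_equivalent :: "bool list \<Rightarrow> bool" where
  "all_equivalent Ss \<longleftrightarrow> (\<forall>P\<in>set Ss. \<forall>Q\<in>set Ss. P \<longleftrightarrow> Q)"

definition primitive_root_mod :: "nat \<Rightarrow> int \<Rightarrow> bool" where
  "primitive_root_mod p a \<longleftrightarrow>
     a mod int p \<in> carrier (units_of (residue_ring (int p))) \<and>
     generate (units_of (residue_ring (int p))) {a mod int p}
       = carrier (units_of (residue_ring (int p)))"

text \<open>
  An element of the group algebra of \<open>G\<close> over a commutative ring given as a type is its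
  coefficient function, extended by 0 outside the carrier of \<open>G\<close>; multiplication is convolution.
  The field with two elements is the type \<^typ>\<open>bit\<close>.
\<close>

definition group_algebra :: "('g, 'm) monoid_scheme \<Rightarrow> ('g \<Rightarrow> 'k::comm_ring_1) ring" where
  "group_algebra G =
     \<lparr>carrier = {f. finite {x. f x \<noteq> 0} \<and> {x. f x \<noteq> 0} \<subseteq> carrier G},
      monoid.mult = (\<lambda>f h z. \<Sum>(x, y) | f x \<noteq> 0 \<and> h y \<noteq> 0 \<and> x \<otimes>\<^bsub>G\<^esub> y = z. f x * h y),
      one = (\<lambda>x. if x = \<one>\<^bsub>G\<^esub> then 1 else 0),
      zero = (\<lambda>x. 0),
      add = (\<lambda>f h x. f x + h x)\<rparr>"

abbreviation F2_algebra :: "('g, 'm) monoid_scheme \<Rightarrow> ('g \<Rightarrow> bit) ring" where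
  "F2_algebra G \<equiv> group_algebra G"

definition group_elt :: "'g \<Rightarrow> 'g \<Rightarrow> 'k::comm_ring_1" where
  "group_elt g = (\<lambda>x. if x = g then 1 else 0)"

definition norm_element :: "('g, 'm) monoid_scheme \<Rightarrow> 'g \<Rightarrow> 'k::comm_ring_1" where
  "norm_element G = (\<lambda>x. \<Sum>g\<in>carrier G. group_elt g x)"

definition augmentation :: "('g \<Rightarrow> 'k::comm_ring_1) \<Rightarrow> 'k" where
  "augmentation f = (\<Sum>x | f x \<noteq> 0. f x)"

definition rotate_down :: "'a vec \<Rightarrow> 'a vec" where
  "rotate_down v = vec (dim_vec v) (\<lambda>i. v $ ((i + dim_vec v - 1) mod dim_vec v))"

definition circulant :: "nat \<Rightarrow> 'a mat \<Rightarrow> bool" where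
  "circulant n A \<longleftrightarrow>
     A \<in> carrier_mat n n \<and> (\<forall>j. Suc j < n \<longrightarrow> col A (Suc j) = rotate_down (col A j))"

definition permutation_matrix :: "nat \<Rightarrow> 'a::zero_neq_one mat \<Rightarrow> bool" where
  "permutation_matrix n A \<longleftrightarrow>
     (\<exists>\<sigma>. \<sigma> permutes {..<n} \<and> A = mat n n (\<lambda>(i, j). if i = \<sigma> j then 1 else 0))"

definition matrix_order :: "nat \<Rightarrow> 'a::semiring_1 mat \<Rightarrow> nat" where
  "matrix_order n A = group.ord (units_of (ring_mat TYPE('a) n ())) A"

text \<open>
  A labeled \<open>(n,n)\<close> bipartite graph is its edge set: the pair \<open>(i, j)\<close> is the edge joining
  the \<open>i\<close>-th vertex of \<open>A\<close> to the \<open>j\<close>-th vertex of \<open>B\<close>. Subscripts run from 0 to \<open>n - 1\<close>,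
  in line with the indexing of matrices.
\<close>

type_synonym bigraph = "(nat \<times> nat) set"

definition complete_bigraph :: "nat \<Rightarrow> bigraph" where
  "complete_bigraph n = {..<n} \<times> {..<n}"

definition bipartite_graph :: "nat \<Rightarrow> bigraph \<Rightarrow> bool" where
  "bipartite_graph n E \<longleftrightarrow> E \<subseteq> {..<n} \<times> {..<n}"

definition biadjacency :: "nat \<Rightarrow> bigraph \<Rightarrow> int mat" where
  "biadjacency n E = mat n n (\<lambda>(i, j). if (i, j) \<in> E then 1 else 0)"

definition circulant_graph :: "nat \<Rightarrow> bigraph \<Rightarrow> bool" where
  "circulant_graph n E \<longleftrightarrow> bipartite_graph n E \<and> circulant n (biadjacency n E)"

definition regular_of_degree :: "nat \<Rightarrow> bigraph \<Rightarrow> nat \<Rightarrow> bool" where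
  "regular_of_degree n E d \<longleftrightarrow>
     (\<forall>i<n. card {e \<in> E. fst e = i} = d) \<and> (\<forall>j<n. card {e \<in> E. snd e = j} = d)"

definition perfect_matchings :: "nat \<Rightarrow> bigraph \<Rightarrow> bigraph set" where
  "perfect_matchings n E =
     {M. M \<subseteq> E \<and> (\<forall>i<n. \<exists>!e. e \<in> M \<and> fst e = i) \<and> (\<forall>j<n. \<exists>!e. e \<in> M \<and> snd e = j)}"

definition pseudopaths :: "bigraph \<Rightarrow> nat \<Rightarrow> nat \<Rightarrow> nat \<Rightarrow> (nat \<times> nat) list set" where
  "pseudopaths E r i j =
     {es. length es = r \<and> es \<noteq> [] \<and> set es \<subseteq> E \<and>
          (\<forall>k. Suc k < r \<longrightarrow> snd (es ! k) = fst (es ! Suc k)) \<and>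
          fst (hd es) = i \<and> snd (last es) = j}"

definition pseudopath_count :: "bigraph \<Rightarrow> nat \<Rightarrow> nat \<Rightarrow> nat \<Rightarrow> nat" where
  "pseudopath_count E r i j = card (pseudopaths E r i j)"

end

theory Submission
  imports Defs "HOL-Number_Theory.Gauss"
begin

text \<open>
  Let \<open>R\<close> be the group algebra of a group of odd prime order \<open>p\<close> over the field with two elements, and let
  \<open>\<nu>\<close> be the norm element. Everything rests on one property of \<open>R\<close>: its only
  idempotents of augmentation 1 are the identity and \<open>\<nu>\<close>.

  Squaring in \<open>R\<close> is the Frobenius map, so an idempotent is a function on the group which is constant on
  the orbits of \<open>x \<mapsto> x \<otimes> x\<close>. If 2 is a primitive root, these orbits are the identity and its
  complement, and there are no further idempotents (\<open>augmentation_one_idempotent_trivial\<close>); otherwise the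
  orbit of a generator yields a new one (\<open>nontrivial_idempotent\<close>).

  Without new idempotents every \<open>f\<close> of augmentation 1 other than \<open>\<nu>\<close> is a unit, because some power
  of \<open>f\<close> is an idempotent acting on \<open>f\<close> as the identity (\<open>unit_if_idempotents_trivial\<close>). Such units then
  allow one to cancel factors as in a field, and an orthogonality argument shows that the only solutions of
  \<open>u [^] p = 1\<close> are the group elements (\<open>pth_root_of_unity_is_group_elt\<close>). Conversely a new idempotent \<open>e\<close> is
  itself a non-unit of augmentation 1, and \<open>e g + (1 + e)\<close> is a \<open>p\<close>-th root of unity
  which is not a group element (\<open>exotic_pth_root_of_unity\<close>). This settles the conditions on \<open>R\<close>; the number
  of units is a matter of counting the elements of augmentation 1.

  The matrix of multiplication by \<open>f\<close> in the basis of powers of a generator is circulant, and this identifies \<open>R\<close>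
  with the circulant matrices (\<open>bij_betw_circ\<close>, \<open>circ_mult\<close>), group elements with circulant permutation
  matrices, \<open>\<nu>\<close> with the all-ones matrix, and the augmentation with the eigenvalue at the all-ones vector.
  Reading the nonzero entries as edges identifies \<open>R\<close> with the circulant graphs. The number of perfect
  matchings is a permanent, hence congruent modulo 2 to the determinant (\<open>det_edge_mat_bit\<close>), and
  pseudopaths are counted by matrix powers (\<open>of_nat_pseudopath_count\<close>). So each condition on matrices or graphs
  is one of the conditions on \<open>R\<close> in disguise.

  Finally, if \<open>p\<close> is congruent to 1 or 7 modulo 8, then 2 is a quadratic residue and hence not a primitive
  root (\<open>primitive_root_two_mod_8\<close>).
\<close>

section \<open>Powers of two modulo an odd prime\<close>

text \<open>
  This is the only form in which primitivity enters the algebra: every exponent prime to \<open>p\<close> is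
  reached from 1 by repeated doubling.
\<close>

lemma primitive_root_mod_two_iff:
  fixes p :: nat
  assumes p: "prime p" "odd p"
  shows "primitive_root_mod p 2 \<longleftrightarrow> (\<forall>m::nat. \<not> p dvd m \<longrightarrow> (\<exists>k::nat. [2 ^ k = m] (mod p)))"
proof -
  have p2: "p > 2"
    using p prime_ge_2_nat[of p] by (cases "p = 2") auto
  interpret residues_prime p "residue_ring (int p)"
    by unfold_locales (simp_all add: p)
  let ?U = "units_of (residue_ring (int p))"
  interpret U: group ?U
    by (rule units_group)
  have carr: "carrier ?U = {1..int p - 1}"
    using p2 by (simp add: units_of_carrier res_prime_units_eq of_nat_diff)
  have pow: "2 [^]\<^bsub>?U\<^esub> k = 2 ^ k mod int p" for k :: nat
  proof -
    have "(2 mod int p) [^]\<^bsub>residue_ring (int p)\<^esub> k = 2 ^ k mod int p"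
      by (rule pow_cong)
    moreover have "2 \<in> Units (residue_ring (int p))"
      using p2 by (simp add: res_prime_units_eq)
    ultimately show ?thesis using p2 by (simp add: units_of_pow)
  qed
  have two: "2 \<in> carrier ?U" using p2 by (simp add: carr)
  have "finite (carrier ?U)" by (simp add: carr)
  then have gen: "generate ?U {2} = range (\<lambda>k::nat. 2 ^ k mod int p)"
    using U.generate_pow_on_finite_carrier[OF _ two] by (auto simp: pow)
  have "primitive_root_mod p 2 \<longleftrightarrow> carrier ?U \<subseteq> range (\<lambda>k::nat. 2 ^ k mod int p)"
    using U.generate_incl[of "{2}"] two p2 unfolding primitive_root_mod_def by (auto simp: gen)
  also have "\<dots> \<longleftrightarrow> (\<forall>m::nat. \<not> p dvd m \<longrightarrow> (\<exists>k::nat. [2 ^ k = m] (mod p)))"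
  proof safe
    fix m :: nat assume *: "carrier ?U \<subseteq> range (\<lambda>k::nat. 2 ^ k mod int p)" and m: "\<not> p dvd m"
    have "int (m mod p) \<in> {1..int p - 1}"
      using m p2 by (auto simp: dvd_eq_mod_eq_0 simp flip: of_nat_mod)
    then obtain k :: nat where "int (m mod p) = 2 ^ k mod int p" using * unfolding carr by blast
    then have "int (m mod p) = int (2 ^ k mod p)" by (simp add: of_nat_mod)
    then show "\<exists>k::nat. [2 ^ k = m] (mod p)" unfolding cong_def by (metis of_nat_eq_iff)
  next
    fix x assume *: "\<forall>m::nat. \<not> p dvd m \<longrightarrow> (\<exists>k::nat. [2 ^ k = m] (mod p))" and "x \<in> carrier ?U"
    then have x: "1 \<le> x" "x < int p" by (auto simp: carr)
    then have "\<not> p dvd nat x" by (auto dest: dvd_imp_le)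
    then obtain k where "[2 ^ k = nat x] (mod p)" using * by blast
    then have "2 ^ k mod p = nat x" using x by (simp add: cong_def nat_less_iff)
    then have "x = int (2 ^ k mod p)" using x by simp
    then show "x \<in> range (\<lambda>k::nat. 2 ^ k mod int p)" by (auto simp: of_nat_mod)
  qed
  finally show ?thesis .
qed

text \<open>
  By Euler's criterion this is the supplementary law that 2 is a quadratic residue. Gauss's lemma gives
  it: with \<open>h = (p - 1) div 2\<close>, the doubles of \<open>1, \<dots>, h\<close> are already reduced modulo \<open>p\<close>, and those exceeding
  \<open>h\<close> come from the \<open>h - h div 2\<close> numbers in the upper half. That count is even exactly for \<open>h\<close> congruent
  to 0 or 3 modulo 4.
\<close>

lemma two_power_half_cong_1:
  fixes p :: nat
  assumes p: "prime p" and p8: "p mod 8 = 1 \<or> p mod 8 = 7"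
  shows "[2 ^ ((p - 1) div 2) = 1] (mod p)"
proof -
  have p2: "p > 2"
    using p p8 prime_gt_1_nat[OF p] by (cases "p = 2") auto
  interpret GAUSS p 2
    by unfold_locales (use p p2 in \<open>auto simp: cong_def\<close>)
  define h where "h = (p - 1) div 2"
  have hp: "p = 2 * h + 1" using odd_p unfolding h_def by (auto elim!: oddE)
  have h: "h mod 4 = 0 \<or> h mod 4 = 3"
  proof -
    have "(2 * h + 1) mod 8 = 1 \<or> (2 * h + 1) mod 8 = 7" using p8 hp by simp
    then show ?thesis by presburger
  qed
  have hi: "(int p - 1) div 2 = int h" using hp by simp
  have "E = (\<lambda>x. int (2 * x)) ` {h div 2 + 1..h}"
  proof (intro equalityI subsetI)
    fix y assume "y \<in> E"
    then obtain x where x: "0 < x" "x \<le> int h" "y = x * 2 mod int p" "int h < y"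
      unfolding E_def C_def B_def A_def hi by auto
    have "y = x * 2" using x hp by simp
    then have "y = int (2 * nat x)" "nat x \<in> {h div 2 + 1..h}" using x by auto
    then show "y \<in> (\<lambda>x. int (2 * x)) ` {h div 2 + 1..h}" by blast
  next
    fix y assume "y \<in> (\<lambda>x. int (2 * x)) ` {h div 2 + 1..h}"
    then obtain x where x: "h div 2 + 1 \<le> x" "x \<le> h" "y = int x * 2" by auto
    have "int x \<in> A" using x unfolding A_def hi by auto
    moreover have "y = int x * 2 mod int p" using x hp by simp
    moreover have "int h < y" using x by linarith
    ultimately show "y \<in> E" unfolding E_def C_def B_def hi by blast
  qed
  moreover have "inj_on (\<lambda>x. int (2 * x)) {h div 2 + 1..h}" by (auto simp: inj_on_def)
  ultimately have cE: "card E = h - h div 2" by (simp add: card_image del: of_nat_mult)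
  have "even (h - h div 2)" using h by presburger
  then have "even (card E)" by (simp add: cE)
  then have "Legendre 2 p = 1" using gauss_lemma by simp
  then have "[1 = 2 ^ h] (mod int p)"
    using euler_criterion[OF p p2, of 2] by (simp add: h_def)
  then have "[int 1 = int (2 ^ h)] (mod int p)" by simp
  then show ?thesis unfolding h_def cong_int_iff by (rule cong_sym)
qed

text \<open>
  Otherwise the exponents of the powers of 2 matter only modulo \<open>(p - 1) div 2\<close>, so there are too few
  powers to fill the \<open>p - 1\<close> nonzero residues.
\<close>

lemma primitive_root_two_mod_8:
  fixes p :: nat
  assumes p: "prime p" "odd p" and "primitive_root_mod p 2"
  shows "p mod 8 = 3 \<or> p mod 8 = 5"
proof (rule ccontr)
  assume "\<not> ?thesis"
  moreover have "p mod 8 \<in> {1, 3, 5, 7}" using p(2) by (auto, presburger)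
  ultimately have *: "[2 ^ ((p - 1) div 2) = 1] (mod p)"
    using two_power_half_cong_1[OF p(1)] by auto
  define h where "h = (p - 1) div 2"
  have p1: "p > 1" using p prime_gt_1_nat[of p] by blast
  have hp: "p = 2 * h + 1" using p(2) unfolding h_def by (auto elim!: oddE)
  \<comment> \<open>Each nonzero residue is a power of 2 with exponent reduced below \<open>h\<close>.\<close>
  have "{1..<p} \<subseteq> (\<lambda>k. 2 ^ k mod p) ` {..<h}"
  proof
    fix m assume m: "m \<in> {1..<p}"
    then have "\<not> p dvd m" by (auto dest: dvd_imp_le)
    then obtain k where k: "[2 ^ k = m] (mod p)"
      using assms(3) primitive_root_mod_two_iff[OF p] by blast
    have "[2 ^ k = (2 ^ h) ^ (k div h) * 2 ^ (k mod h)] (mod p)"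
      by (simp flip: power_mult power_add)
    also have "[(2 ^ h) ^ (k div h) * 2 ^ (k mod h) = 1 ^ (k div h) * 2 ^ (k mod h)] (mod p)"
      using * unfolding h_def by (intro cong_mult cong_pow cong_refl)
    finally have "[2 ^ (k mod h) = m] (mod p)" using k by (metis cong_sym cong_trans mult_1 power_one)
    then have "m = 2 ^ (k mod h) mod p" using m by (simp add: cong_def)
    moreover have "k mod h < h" using hp p1 by (intro mod_less_divisor) linarith
    ultimately show "m \<in> (\<lambda>k. 2 ^ k mod p) ` {..<h}" by blast
  qed
  then have "card {1..<p} \<le> card {..<h}" by (rule surj_card_le[rotated]) simp
  then show False using hp p1 by simp
qed

section \<open>The group algebra of a finite commutative group\<close>

locale finite_comm_group = comm_group G for G (structure) +
  assumes fin: "finite (carrier G)"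
begin

abbreviation KG :: "('a \<Rightarrow> 'k::comm_ring_1) ring" where
  "KG \<equiv> group_algebra G"

lemma carrier_iff: "f \<in> carrier KG \<longleftrightarrow> (\<forall>x. x \<notin> carrier G \<longrightarrow> f x = 0)"
  unfolding group_algebra_def using fin by (auto intro: finite_subset)

lemma carrierI: "(\<And>x. x \<notin> carrier G \<Longrightarrow> f x = 0) \<Longrightarrow> f \<in> carrier KG"
  by (simp add: carrier_iff)

lemma outside: "f \<in> carrier KG \<Longrightarrow> x \<notin> carrier G \<Longrightarrow> f x = 0"
  by (simp add: carrier_iff)

lemma KG_eqI:
  assumes "f \<in> carrier KG" "h \<in> carrier KG" "\<And>x. x \<in> carrier G \<Longrightarrow> f x = h x"
  shows "f = h"
  using assms by (metis ext outside)

lemma add_apply: "(f \<oplus>\<^bsub>KG\<^esub> h) x = f x + h x"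
  by (simp add: group_algebra_def)

lemma zero_apply: "\<zero>\<^bsub>KG\<^esub> x = 0"
  by (simp add: group_algebra_def)

lemma one_eq_group_elt: "\<one>\<^bsub>KG\<^esub> = group_elt \<one>"
  by (simp add: group_algebra_def group_elt_def)

lemma mult_apply_double:
  assumes "f \<in> carrier KG" "h \<in> carrier KG"
  shows "(f \<otimes>\<^bsub>KG\<^esub> h) z =
    (\<Sum>x\<in>carrier G. \<Sum>y\<in>carrier G. if x \<otimes> y = z then f x * h y else 0)"
proof -
  have "(f \<otimes>\<^bsub>KG\<^esub> h) z = (\<Sum>(x, y) | f x \<noteq> 0 \<and> h y \<noteq> 0 \<and> x \<otimes> y = z. f x * h y)"
    by (simp add: group_algebra_def)
  also have "\<dots> = (\<Sum>(x, y) \<in> carrier G \<times> carrier G. if x \<otimes> y = z then f x * h y else 0)"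
    by (rule sum.mono_neutral_cong_left) (use fin assms in \<open>auto simp: carrier_iff split: if_splits\<close>)
  finally show ?thesis by (simp add: sum.cartesian_product)
qed

text \<open>
  Pairing with an arbitrary function \<open>\<phi>\<close> on the group turns convolution into a plain double sum. Ring laws
  and the augmentation of a product can then be read off without reindexing fibres of the
  group multiplication; \<open>KG_eqI_pairing\<close> returns from pairings to elements.
\<close>

lemma sum_mult_pairing:
  assumes "f \<in> carrier KG" "h \<in> carrier KG"
  shows "(\<Sum>z\<in>carrier G. (f \<otimes>\<^bsub>KG\<^esub> h) z * \<phi> z) =
    (\<Sum>x\<in>carrier G. \<Sum>y\<in>carrier G. f x * h y * \<phi> (x \<otimes> y))"
proof -
  have "(\<Sum>z\<in>carrier G. (f \<otimes>\<^bsub>KG\<^esub> h) z * \<phi> z) =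
      (\<Sum>z\<in>carrier G. \<Sum>x\<in>carrier G. \<Sum>y\<in>carrier G. if x \<otimes> y = z then f x * h y * \<phi> z else 0)"
    by (simp add: mult_apply_double[OF assms] sum_distrib_right if_distrib[of "\<lambda>t. t * _"] cong: if_cong)
  also have "\<dots> = (\<Sum>x\<in>carrier G. \<Sum>y\<in>carrier G. \<Sum>z\<in>carrier G. if x \<otimes> y = z then f x * h y * \<phi> z else 0)"
    by (subst sum.swap, rule sum.cong[OF refl], rule sum.swap)
  also have "\<dots> = (\<Sum>x\<in>carrier G. \<Sum>y\<in>carrier G. f x * h y * \<phi> (x \<otimes> y))"
    by (intro sum.cong refl) (simp add: fin)
  finally show ?thesis .
qed

lemma sum_mult_delta:
  fixes k :: "'a \<Rightarrow> 'k::comm_ring_1"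
  assumes "x \<in> carrier G"
  shows "(\<Sum>z\<in>carrier G. k z * (if z = x then 1 else 0)) = k x"
  using assms fin by (simp add: if_distrib[of "\<lambda>t. _ * t"] cong: if_cong)

lemma KG_eqI_pairing:
  fixes f h :: "'a \<Rightarrow> 'k::comm_ring_1"
  assumes "f \<in> carrier KG" "h \<in> carrier KG"
    and "\<And>\<phi>. (\<Sum>z\<in>carrier G. f z * \<phi> z) = (\<Sum>z\<in>carrier G. h z * \<phi> z)"
  shows "f = h"
proof (rule KG_eqI[OF assms(1,2)])
  fix x assume x: "x \<in> carrier G"
  show "f x = h x" using assms(3)[of "\<lambda>z. if z = x then 1 else 0"] x by (simp only: sum_mult_delta)
qed

lemma mult_closed:
  assumes "f \<in> carrier KG" "h \<in> carrier KG"
  shows "f \<otimes>\<^bsub>KG\<^esub> h \<in> carrier KG"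
proof (rule carrierI)
  fix z assume "z \<notin> carrier G"
  then have "x \<otimes> y \<noteq> z" if "x \<in> carrier G" "y \<in> carrier G" for x y using that by auto
  then show "(f \<otimes>\<^bsub>KG\<^esub> h) z = 0" by (simp add: mult_apply_double[OF assms])
qed

lemma group_elt_closed [simp]: "g \<in> carrier G \<Longrightarrow> group_elt g \<in> carrier KG"
  by (auto simp: carrier_iff group_elt_def)

lemma sum_group_elt [simp]:
  "g \<in> carrier G \<Longrightarrow> (\<Sum>z\<in>carrier G. group_elt g z * \<phi> z) = \<phi> g"
  by (simp add: group_elt_def if_distrib[of "\<lambda>t. t * _"] fin cong: if_cong)

lemma mult_assoc:
  assumes f: "f \<in> carrier KG" and h: "h \<in> carrier KG" and k: "k \<in> carrier KG"
  shows "(f \<otimes>\<^bsub>KG\<^esub> h) \<otimes>\<^bsub>KG\<^esub> k = f \<otimes>\<^bsub>KG\<^esub> (h \<otimes>\<^bsub>KG\<^esub> k)"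
proof (rule KG_eqI_pairing)
  fix \<phi>
  have "(\<Sum>z\<in>carrier G. ((f \<otimes>\<^bsub>KG\<^esub> h) \<otimes>\<^bsub>KG\<^esub> k) z * \<phi> z) =
      (\<Sum>w\<in>carrier G. (f \<otimes>\<^bsub>KG\<^esub> h) w * (\<Sum>c\<in>carrier G. k c * \<phi> (w \<otimes> c)))"
    by (simp add: sum_mult_pairing f h k mult_closed sum_distrib_left mult.assoc)
  also have "\<dots> = (\<Sum>a\<in>carrier G. \<Sum>b\<in>carrier G. \<Sum>c\<in>carrier G. f a * h b * k c * \<phi> (a \<otimes> b \<otimes> c))"
    by (subst sum_mult_pairing[OF f h]) (simp add: sum_distrib_left mult.assoc)
  also have "\<dots> = (\<Sum>a\<in>carrier G. \<Sum>b\<in>carrier G. \<Sum>c\<in>carrier G. f a * (h b * k c * \<phi> (a \<otimes> (b \<otimes> c))))"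
    by (intro sum.cong refl) (simp add: m_assoc mult.assoc)
  also have "\<dots> = (\<Sum>a\<in>carrier G. f a * (\<Sum>w\<in>carrier G. (h \<otimes>\<^bsub>KG\<^esub> k) w * \<phi> (a \<otimes> w)))"
    unfolding sum_mult_pairing[OF h k] by (simp add: sum_distrib_left)
  also have "\<dots> = (\<Sum>z\<in>carrier G. (f \<otimes>\<^bsub>KG\<^esub> (h \<otimes>\<^bsub>KG\<^esub> k)) z * \<phi> z)"
    by (simp add: sum_mult_pairing[OF f mult_closed[OF h k]] sum_distrib_left mult.assoc)
  finally show "(\<Sum>z\<in>carrier G. ((f \<otimes>\<^bsub>KG\<^esub> h) \<otimes>\<^bsub>KG\<^esub> k) z * \<phi> z) =
      (\<Sum>z\<in>carrier G. (f \<otimes>\<^bsub>KG\<^esub> (h \<otimes>\<^bsub>KG\<^esub> k)) z * \<phi> z)" .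
qed (simp_all add: f h k mult_closed)

lemma mult_comm:
  assumes "f \<in> carrier KG" "h \<in> carrier KG"
  shows "f \<otimes>\<^bsub>KG\<^esub> h = h \<otimes>\<^bsub>KG\<^esub> f"
proof (rule KG_eqI_pairing)
  fix \<phi>
  have "(\<Sum>z\<in>carrier G. (f \<otimes>\<^bsub>KG\<^esub> h) z * \<phi> z) =
    (\<Sum>x\<in>carrier G. \<Sum>y\<in>carrier G. h y * f x * \<phi> (y \<otimes> x))"
    unfolding sum_mult_pairing[OF assms] by (intro sum.cong refl) (simp add: m_comm mult.commute)
  also have "\<dots> = (\<Sum>y\<in>carrier G. \<Sum>x\<in>carrier G. h y * f x * \<phi> (y \<otimes> x))" by (rule sum.swap)
  finally show "(\<Sum>z\<in>carrier G. (f \<otimes>\<^bsub>KG\<^esub> h) z * \<phi> z) = (\<Sum>z\<in>carrier G. (h \<otimes>\<^bsub>KG\<^esub> f) z * \<phi> z)"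
    by (simp add: sum_mult_pairing assms)
qed (simp_all add: assms mult_closed)

lemma group_algebra_cring: "cring (KG :: ('a \<Rightarrow> 'k::comm_ring_1) ring)"
proof (rule cringI)
  show "abelian_group (KG :: ('a \<Rightarrow> 'k) ring)"
  proof (rule abelian_groupI)
    fix f :: "'a \<Rightarrow> 'k" assume "f \<in> carrier KG"
    then show "\<exists>h\<in>carrier KG. h \<oplus>\<^bsub>KG\<^esub> f = \<zero>\<^bsub>KG\<^esub>"
      by (intro bexI[of _ "\<lambda>x. - f x"]) (auto simp: carrier_iff add_apply zero_apply)
  qed (auto simp: carrier_iff add_apply zero_apply add_ac)
  show "comm_monoid (KG :: ('a \<Rightarrow> 'k) ring)"
  proof (rule comm_monoidI)
    fix f :: "'a \<Rightarrow> 'k" assume f: "f \<in> carrier KG"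
    show "\<one>\<^bsub>KG\<^esub> \<otimes>\<^bsub>KG\<^esub> f = f"
    proof (rule KG_eqI_pairing)
      fix \<phi>
      have "(\<Sum>z\<in>carrier G. (\<one>\<^bsub>KG\<^esub> \<otimes>\<^bsub>KG\<^esub> f) z * \<phi> z) =
          (\<Sum>x\<in>carrier G. group_elt \<one> x * (\<Sum>y\<in>carrier G. f y * \<phi> (x \<otimes> y)))"
        by (simp add: one_eq_group_elt sum_mult_pairing f sum_distrib_left mult.assoc)
      then show "(\<Sum>z\<in>carrier G. (\<one>\<^bsub>KG\<^esub> \<otimes>\<^bsub>KG\<^esub> f) z * \<phi> z) = (\<Sum>z\<in>carrier G. f z * \<phi> z)"
        by simp
    qed (simp_all add: f one_eq_group_elt mult_closed)
  qed (auto simp: one_eq_group_elt intro: mult_closed mult_assoc mult_comm)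
  fix f h k :: "'a \<Rightarrow> 'k"
  assume *: "f \<in> carrier KG" "h \<in> carrier KG" "k \<in> carrier KG"
  have fh: "f \<oplus>\<^bsub>KG\<^esub> h \<in> carrier KG" using * by (simp add: carrier_iff add_apply)
  show "(f \<oplus>\<^bsub>KG\<^esub> h) \<otimes>\<^bsub>KG\<^esub> k = f \<otimes>\<^bsub>KG\<^esub> k \<oplus>\<^bsub>KG\<^esub> h \<otimes>\<^bsub>KG\<^esub> k"
  proof (rule KG_eqI_pairing)
    show "f \<otimes>\<^bsub>KG\<^esub> k \<oplus>\<^bsub>KG\<^esub> h \<otimes>\<^bsub>KG\<^esub> k \<in> carrier KG"
      using mult_closed[OF *(1,3)] mult_closed[OF *(2,3)] by (simp add: carrier_iff add_apply)
    show "(f \<oplus>\<^bsub>KG\<^esub> h) \<otimes>\<^bsub>KG\<^esub> k \<in> carrier KG"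
      by (rule mult_closed[OF fh *(3)])
    fix \<phi>
    show "(\<Sum>z\<in>carrier G. ((f \<oplus>\<^bsub>KG\<^esub> h) \<otimes>\<^bsub>KG\<^esub> k) z * \<phi> z) =
        (\<Sum>z\<in>carrier G. (f \<otimes>\<^bsub>KG\<^esub> k \<oplus>\<^bsub>KG\<^esub> h \<otimes>\<^bsub>KG\<^esub> k) z * \<phi> z)"
      by (simp add: sum_mult_pairing fh * add_apply distrib_right sum.distrib)
  qed
qed

lemma augmentation_eq_sum: "f \<in> carrier KG \<Longrightarrow> augmentation f = (\<Sum>x\<in>carrier G. f x)"
  unfolding augmentation_def by (rule sum.mono_neutral_left) (use fin in \<open>auto simp: carrier_iff\<close>)

lemma augmentation_mult:
  assumes "f \<in> carrier KG" "h \<in> carrier KG"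
  shows "augmentation (f \<otimes>\<^bsub>KG\<^esub> h) = augmentation f * augmentation h"
  using sum_mult_pairing[OF assms, of "\<lambda>_. 1"]
  by (simp add: augmentation_eq_sum mult_closed assms sum_product)

lemma augmentation_group_elt: "g \<in> carrier G \<Longrightarrow> augmentation (group_elt g :: 'a \<Rightarrow> 'k::comm_ring_1) = 1"
  using sum_group_elt[of g "\<lambda>_. 1 :: 'k"] by (simp add: augmentation_eq_sum)

lemma augmentation_add:
  assumes "f \<in> carrier KG" "h \<in> carrier KG"
  shows "augmentation (f \<oplus>\<^bsub>KG\<^esub> h) = augmentation f + augmentation h"
proof -
  have "f \<oplus>\<^bsub>KG\<^esub> h \<in> carrier KG" using assms by (simp add: carrier_iff add_apply)
  then show ?thesis by (simp add: augmentation_eq_sum assms add_apply sum.distrib)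
qed

lemma norm_element_apply: "norm_element G x = (if x \<in> carrier G then 1 else 0)"
  using fin by (simp add: norm_element_def group_elt_def)

lemma norm_element_closed [simp]: "norm_element G \<in> carrier KG"
  by (simp add: carrier_iff norm_element_apply)

lemma mult_apply:
  assumes "f \<in> carrier KG" "h \<in> carrier KG" "z \<in> carrier G"
  shows "(f \<otimes>\<^bsub>KG\<^esub> h) z = (\<Sum>y\<in>carrier G. f (z \<otimes> inv y) * h y)"
proof -
  have "(\<Sum>x\<in>carrier G. if x \<otimes> y = z then f x * h y else 0) = f (z \<otimes> inv y) * h y"
    if y: "y \<in> carrier G" for y
  proof -
    have "(\<Sum>x\<in>carrier G. if x \<otimes> y = z then f x * h y else 0) =
        (\<Sum>x\<in>carrier G. if x = z \<otimes> inv y then f x * h y else 0)"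
      by (intro sum.cong refl if_cong) (use y assms(3) in \<open>auto simp: inv_solve_right m_assoc\<close>)
    then show ?thesis using y assms(3) fin by simp
  qed
  then show ?thesis
    unfolding mult_apply_double[OF assms(1,2)] by (subst sum.swap) simp
qed

lemma mult_group_elt_apply:
  assumes "f \<in> carrier KG" "g \<in> carrier G" "z \<in> carrier G"
  shows "(f \<otimes>\<^bsub>KG\<^esub> group_elt g) z = f (z \<otimes> inv g)"
  using assms sum_group_elt[of g "\<lambda>y. f (z \<otimes> inv y)"] by (simp add: mult_apply mult.commute)

text \<open>
  The norm element is fixed by all translations, so multiplying by it forgets everything but the
  augmentation.
\<close>

lemma mult_norm_element_apply:
  assumes "f \<in> carrier KG" "z \<in> carrier G"
  shows "(f \<otimes>\<^bsub>KG\<^esub> norm_element G) z = augmentation f"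
proof -
  have "(f \<otimes>\<^bsub>KG\<^esub> norm_element G) z = (norm_element G \<otimes>\<^bsub>KG\<^esub> f) z"
    by (simp add: mult_comm assms)
  also have "\<dots> = (\<Sum>y\<in>carrier G. f y)"
    using assms by (simp add: mult_apply norm_element_apply)
  finally show ?thesis by (simp add: augmentation_eq_sum assms)
qed

lemma group_elt_mult:
  assumes "g \<in> carrier G" "h \<in> carrier G"
  shows "group_elt g \<otimes>\<^bsub>KG\<^esub> group_elt h = (group_elt (g \<otimes> h) :: 'a \<Rightarrow> 'k::comm_ring_1)"
  by (rule KG_eqI) (use assms in \<open>auto simp: mult_closed mult_group_elt_apply, auto simp: group_elt_def inv_solve_right' m_assoc\<close>)

lemma group_elt_inj: "(group_elt g :: 'a \<Rightarrow> 'k::comm_ring_1) = group_elt h \<longleftrightarrow> g = h"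
  by (metis group_elt_def zero_neq_one)

end

section \<open>Squaring in the group algebra over the field with two elements\<close>

text \<open>
  Each off-diagonal pair contributes the same term twice, which cancels. This is what makes squaring in
  the group algebra act on group elements alone.
\<close>

lemma sum_symmetric_char_2:
  fixes s :: "'a \<Rightarrow> 'a \<Rightarrow> 'b::comm_ring_1"
  assumes "finite A" and "\<And>x y. x \<in> A \<Longrightarrow> y \<in> A \<Longrightarrow> s x y = s y x"
    and char: "(2 :: 'b) = 0"
  shows "(\<Sum>x\<in>A. \<Sum>y\<in>A. s x y) = (\<Sum>x\<in>A. s x x)"
  using assms(1,2)
proof induction
  case (insert a A)
  let ?T = "\<Sum>y\<in>A. s a y" and ?D = "\<Sum>x\<in>A. s x x"
  have "(\<Sum>x\<in>A. s x a) = ?T" using insert.prems by (intro sum.cong refl) blast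
  then have "(\<Sum>x\<in>insert a A. \<Sum>y\<in>insert a A. s x y) = (s a a + ?T) + (?T + ?D)"
    using insert by (simp add: sum.distrib)
  also have "\<dots> = s a a + ?D + 2 * ?T" by (simp add: algebra_simps)
  finally show ?case using insert char by simp
qed simp

text \<open>
  The group is written with a chosen non-identity element \<open>g\<close>, which generates it. Its powers serve as
  coordinates, both to translate exponents into residues modulo \<open>p\<close> and to index the rows and columns of
  circulant matrices.
\<close>

locale odd_prime_group = finite_comm_group G for G (structure) +
  fixes p :: nat and g :: 'a
  assumes p_prime: "prime p" and p_odd: "odd p" and order_eq: "Coset.order G = p"
    and g_closed [simp]: "g \<in> carrier G" and g_neq_one: "g \<noteq> \<one>"
begin

abbreviation F2G :: "('a \<Rightarrow> bit) ring" where
  "F2G \<equiv> F2_algebra G"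

abbreviation \<nu> :: "'a \<Rightarrow> bit" where
  "\<nu> \<equiv> norm_element G"

sublocale R: cring F2G
  by (rule group_algebra_cring)

lemma p_gt_2: "p > 2"
  using p_prime p_odd prime_ge_2_nat[of p] by (cases "p = 2") auto

lemma pow_p: "x \<in> carrier G \<Longrightarrow> x [^] p = \<one>"
  using pow_order_eq_1 order_eq by simp

lemma ord_g: "ord g = p"
  using ord_dvd_group_order[OF g_closed] p_prime g_neq_one ord_eq_1[OF g_closed]
  by (auto simp: order_eq prime_nat_iff)

lemma pow_g_eq_iff: "g [^] (i::nat) = g [^] (j::nat) \<longleftrightarrow> [i = j] (mod p)"
proof -
  have "g [^] i = g [^] j \<longleftrightarrow> g [^] int i = g [^] int j" by (simp add: int_pow_int)
  also have "\<dots> \<longleftrightarrow> [int j = int i] (mod int p)"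
    by (simp add: int_pow_eq ord_g cong_iff_dvd_diff)
  finally show ?thesis by (auto simp: cong_int_iff cong_sym_eq)
qed

lemma bij_betw_pow_g: "bij_betw (\<lambda>i::nat. g [^] i) {..<p} (carrier G)"
proof -
  have inj: "inj_on (\<lambda>i::nat. g [^] i) {..<p}"
    by (auto simp: inj_on_def pow_g_eq_iff cong_def)
  then have "card ((\<lambda>i::nat. g [^] i) ` {..<p}) = card (carrier G)"
    using order_eq by (simp add: card_image Coset.order_def)
  then have "(\<lambda>i::nat. g [^] i) ` {..<p} = carrier G"
    by (intro card_subset_eq[OF fin]) auto
  with inj show ?thesis by (simp add: bij_betw_def)
qed

lemma obtain_pow_g:
  assumes "x \<in> carrier G"
  obtains i :: nat where "i < p" "x = g [^] i"
  using assms bij_betw_pow_g unfolding bij_betw_def by blast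

lemma of_nat_p_bit: "(of_nat p :: bit) = 1"
  using p_odd by (metis bit_not_one_iff of_nat_eq_0_iff even_of_nat_iff even_zero)

lemma augmentation_norm: "augmentation \<nu> = 1"
  using order_eq of_nat_p_bit by (simp add: augmentation_eq_sum norm_element_apply Coset.order_def)

lemma aug_one: "augmentation \<one>\<^bsub>F2G\<^esub> = 1"
  by (simp add: one_eq_group_elt augmentation_group_elt)

lemma augmentation_pow:
  "f \<in> carrier F2G \<Longrightarrow> augmentation (f [^]\<^bsub>F2G\<^esub> (n::nat)) = augmentation f ^ n"
  by (induction n) (simp_all add: aug_one augmentation_mult)

text \<open>
  Over the field with two elements the norm element absorbs every element of augmentation 1 and
  kills every element of augmentation 0; in particular it is idempotent.
\<close>

lemma mult_norm:
  assumes "f \<in> carrier F2G"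
  shows "f \<otimes>\<^bsub>F2G\<^esub> \<nu> = (if augmentation f = 0 then \<zero>\<^bsub>F2G\<^esub> else \<nu>)"
  by (rule KG_eqI)
    (use assms in \<open>auto simp: mult_closed mult_norm_element_apply norm_element_apply zero_apply simp del: R.r_null\<close>)

lemma group_elt_pow:
  assumes "x \<in> carrier G"
  shows "group_elt x [^]\<^bsub>F2G\<^esub> (n::nat) = group_elt (x [^] n)"
  by (induction n) (use assms in \<open>simp_all add: one_eq_group_elt group_elt_mult\<close>)

lemma add_self: "f \<oplus>\<^bsub>F2G\<^esub> f = \<zero>\<^bsub>F2G\<^esub>"
  by (auto simp: add_apply zero_apply)

lemma pow_cong_mod_p:
  assumes "x \<in> carrier G" "[m = n] (mod p)"
  shows "x [^] m = x [^] n"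
proof -
  obtain i :: nat where "x = g [^] i" using obtain_pow_g[OF assms(1)] by blast
  then show ?thesis
    using assms(2) by (simp add: nat_pow_pow pow_g_eq_iff cong_scalar_left)
qed

text \<open>
  Halving is possible because \<open>p\<close> is odd: \<open>(p + 1) div 2\<close> is an inverse of 2 modulo \<open>p\<close>.
\<close>

lemma square_inj:
  assumes "x \<in> carrier G" "y \<in> carrier G" "x \<otimes> x = y \<otimes> y"
  shows "x = y"
proof -
  have *: "(z \<otimes> z) [^] (Suc p div 2) = z" if "z \<in> carrier G" for z
  proof -
    have "(z \<otimes> z) [^] (Suc p div 2) = z [^] (2 * (Suc p div 2))"
      unfolding mult_2 using that by (simp only: nat_pow_distrib nat_pow_mult)
    also have "2 * (Suc p div 2) = Suc p" using p_odd by simp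
    finally show ?thesis using that by (simp add: pow_p)
  qed
  have "x = (x \<otimes> x) [^] (Suc p div 2)" by (rule *[OF assms(1), symmetric])
  also have "\<dots> = y" unfolding assms(3) by (rule *[OF assms(2)])
  finally show ?thesis .
qed

lemma square_obtain:
  assumes "y \<in> carrier G"
  obtains x where "x \<in> carrier G" "y = x \<otimes> x"
proof -
  have "inj_on (\<lambda>x. x \<otimes> x) (carrier G)" by (auto intro: inj_onI square_inj)
  then have "(\<lambda>x. x \<otimes> x) ` carrier G = carrier G"
    by (intro endo_inj_surj fin) auto
  with assms that show thesis by blast
qed

text \<open>
  Squaring is the Frobenius map: it leaves the coefficients alone and squares the group elements that
  carry them.
\<close>

lemma frobenius:
  assumes f: "f \<in> carrier F2G" and x: "x \<in> carrier G"
  shows "(f \<otimes>\<^bsub>F2G\<^esub> f) (x \<otimes> x) = f x"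
proof -
  define \<phi> :: "'a \<Rightarrow> bit" where "\<phi> = (\<lambda>z. if z = x \<otimes> x then 1 else 0)"
  have "(f \<otimes>\<^bsub>F2G\<^esub> f) (x \<otimes> x) = (\<Sum>z\<in>carrier G. (f \<otimes>\<^bsub>F2G\<^esub> f) z * \<phi> z)"
    unfolding \<phi>_def using x by (simp only: sum_mult_delta m_closed)
  also have "\<dots> = (\<Sum>a\<in>carrier G. \<Sum>b\<in>carrier G. f a * f b * \<phi> (a \<otimes> b))"
    by (rule sum_mult_pairing[OF f f])
  also have "\<dots> = (\<Sum>a\<in>carrier G. f a * f a * \<phi> (a \<otimes> a))"
    by (rule sum_symmetric_char_2[OF fin]) (simp_all add: m_comm mult.commute)
  also have "\<dots> = (\<Sum>a\<in>carrier G. if a = x then f a else 0)"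
    by (intro sum.cong refl) (auto simp: \<phi>_def dest: square_inj[OF _ x])
  also have "\<dots> = f x" using fin x by simp
  finally show ?thesis .
qed

section \<open>Idempotents and the primitive root condition\<close>

lemma idempotent_iff:
  assumes "e \<in> carrier F2G"
  shows "e \<otimes>\<^bsub>F2G\<^esub> e = e \<longleftrightarrow> (\<forall>x\<in>carrier G. e (x \<otimes> x) = e x)"
proof
  assume "e \<otimes>\<^bsub>F2G\<^esub> e = e"
  then show "\<forall>x\<in>carrier G. e (x \<otimes> x) = e x" using frobenius[OF assms] by simp
next
  assume *: "\<forall>x\<in>carrier G. e (x \<otimes> x) = e x"
  show "e \<otimes>\<^bsub>F2G\<^esub> e = e"
  proof (rule KG_eqI)
    fix y assume "y \<in> carrier G"
    then obtain x where "x \<in> carrier G" "y = x \<otimes> x" by (rule square_obtain)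
    then show "(e \<otimes>\<^bsub>F2G\<^esub> e) y = e y" using * frobenius[OF assms] by simp
  qed (simp_all add: assms)
qed

lemma frobenius_iterate:
  assumes "f \<in> carrier F2G" "x \<in> carrier G"
  shows "(f [^]\<^bsub>F2G\<^esub> (2 ^ k :: nat)) (x [^] (2 ^ k :: nat)) = f x"
proof (induction k)
  case (Suc k)
  have "(2::nat) ^ Suc k = 2 ^ k + 2 ^ k" by simp
  then show ?case
    using assms Suc frobenius[of "f [^]\<^bsub>F2G\<^esub> (2 ^ k :: nat)" "x [^] (2 ^ k :: nat)"]
    by (simp only: R.nat_pow_mult[symmetric] nat_pow_mult[symmetric] R.nat_pow_closed nat_pow_closed)
qed (use assms in simp)

text \<open>
  Iterating Frobenius \<open>p - 1\<close> times moves the coefficient of \<open>x\<close> to \<open>x\<close> raised to \<open>2 ^ (p - 1)\<close>, which is \<open>x\<close>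
  again by Fermat's theorem.
\<close>

lemma pow_two_power_p_minus_1:
  assumes "f \<in> carrier F2G"
  shows "f [^]\<^bsub>F2G\<^esub> (2 ^ (p - 1) :: nat) = f"
proof (rule KG_eqI)
  fix x assume x: "x \<in> carrier G"
  have "\<not> p dvd 2" using p_gt_2 by (auto dest: dvd_imp_le)
  then have "[2 ^ (p - 1) = 1] (mod p)" by (rule fermat_theorem[OF p_prime])
  then have "x [^] (2 ^ (p - 1) :: nat) = x"
    using pow_cong_mod_p[OF x, of "2 ^ (p - 1)" 1] x by simp
  then show "(f [^]\<^bsub>F2G\<^esub> (2 ^ (p - 1) :: nat)) x = f x"
    using frobenius_iterate[OF assms x, of "p - 1"] by simp
qed (simp_all add: assms)

lemma idempotent_pow:
  assumes "e \<in> carrier F2G" "e \<otimes>\<^bsub>F2G\<^esub> e = e" "x \<in> carrier G"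
  shows "e (x [^] (2 ^ k :: nat)) = e x"
proof (induction k)
  case (Suc k)
  have "x [^] (2 ^ Suc k :: nat) = x [^] (2 ^ k :: nat) \<otimes> x [^] (2 ^ k :: nat)"
    using assms(3) by (simp add: nat_pow_mult mult_2)
  then show ?case
    using Suc assms idempotent_iff[OF assms(1)] by simp
qed (use assms in simp)

text \<open>
  The coefficients of an idempotent are constant along orbits of squaring. When 2 is a primitive root
  the only orbits are the identity and its complement. The complement has even size \<open>p - 1\<close>, so the
  augmentation is the coefficient at the identity and only two idempotents remain.
\<close>

lemma augmentation_one_idempotent_trivial:
  assumes prim: "primitive_root_mod p 2"
    and e: "e \<in> carrier F2G" "e \<otimes>\<^bsub>F2G\<^esub> e = e" and aug: "augmentation e \<noteq> 0"
  shows "e = \<one>\<^bsub>F2G\<^esub> \<or> e = \<nu>"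
proof -
  have const: "e x = e g" if x: "x \<in> carrier G" "x \<noteq> \<one>" for x
  proof -
    obtain i :: nat where i: "x = g [^] i" using obtain_pow_g[OF x(1)] by blast
    then have "\<not> p dvd i" using x(2) pow_eq_id[OF g_closed] ord_g by auto
    then obtain k where "[2 ^ k = i] (mod p)"
      using prim primitive_root_mod_two_iff[OF p_prime p_odd] by blast
    then have "x = g [^] (2 ^ k :: nat)" unfolding i pow_g_eq_iff by (rule cong_sym)
    then show ?thesis using idempotent_pow[OF e g_closed] by simp
  qed
  have "augmentation e = e \<one> + (\<Sum>x\<in>carrier G - {\<one>}. e x)"
    using sum.remove[OF fin one_closed, of e] by (simp only: augmentation_eq_sum e)
  also have "(\<Sum>x\<in>carrier G - {\<one>}. e x) = of_nat (p - 1) * e g"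
    using fin order_eq by (simp add: const Coset.order_def)
  also have "(of_nat (p - 1) :: bit) = 0"
    using p_gt_2 of_nat_p_bit by (simp add: of_nat_diff)
  finally have e1: "e \<one> = 1" using aug by simp
  show ?thesis
  proof (cases "e g = 0")
    case True
    have "e = \<one>\<^bsub>F2G\<^esub>"
      by (rule KG_eqI)
        (use e const e1 True in \<open>auto simp: one_eq_group_elt, auto simp: group_elt_def\<close>)
    then show ?thesis ..
  next
    case False
    then have "e x = 1" if "x \<in> carrier G" for x
      using const[OF that] e1 by (cases "x = \<one>") auto
    then have "e = \<nu>"
      by (intro KG_eqI) (simp_all add: e norm_element_apply)
    then show ?thesis ..
  qed
qed

text \<open>
  A finite set that squaring maps injectively into itself is permuted by squaring, so membership of
  \<open>x \<otimes> x\<close> and of \<open>x\<close> agree and Frobenius fixes the indicator function.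
\<close>

lemma indicator_idempotent:
  fixes S
  assumes S: "S \<subseteq> carrier G" and closed: "\<And>x. x \<in> S \<Longrightarrow> x \<otimes> x \<in> S"
  defines "s \<equiv> (\<lambda>x. if x \<in> S then 1 else 0 :: bit)"
  shows "s \<in> carrier F2G" "s \<otimes>\<^bsub>F2G\<^esub> s = s"
proof -
  show s: "s \<in> carrier F2G" using S by (auto simp: carrier_iff s_def)
  have "inj_on (\<lambda>x. x \<otimes> x) S" using S by (auto intro: inj_onI square_inj)
  then have surj: "(\<lambda>x. x \<otimes> x) ` S = S"
    using closed finite_subset[OF S fin] by (intro endo_inj_surj) auto
  have "x \<otimes> x \<in> S \<longleftrightarrow> x \<in> S" if "x \<in> carrier G" for x
  proof
    assume "x \<otimes> x \<in> S"
    then obtain y where "y \<in> S" "x \<otimes> x = y \<otimes> y" using surj by blast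
    then show "x \<in> S" using square_inj that S by blast
  qed (rule closed)
  then show "s \<otimes>\<^bsub>F2G\<^esub> s = s" unfolding idempotent_iff[OF s] by (simp add: s_def)
qed

text \<open>
  If 2 is not a primitive root, the orbit of \<open>g\<close> under squaring is a proper part of the non-identity
  elements, and its indicator, adjusted at the identity to have odd support, is the idempotent wanted.
\<close>

lemma nontrivial_idempotent:
  assumes "\<not> primitive_root_mod p 2"
  obtains e where "e \<in> carrier F2G" "e \<otimes>\<^bsub>F2G\<^esub> e = e" "augmentation e \<noteq> 0"
    "e \<noteq> \<one>\<^bsub>F2G\<^esub>" "e \<noteq> \<nu>"
proof -
  obtain m :: nat where m: "\<not> p dvd m" "\<And>k. \<not> [2 ^ k = m] (mod p)"
    using assms primitive_root_mod_two_iff[OF p_prime p_odd] by blast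
  define Orb where "Orb = range (\<lambda>k. g [^] (2 ^ k :: nat))"
  \<comment> \<open>The identity is added when needed to make the support odd, which gives augmentation 1.\<close>
  define S where "S = (if odd (card Orb) then Orb else insert \<one> Orb)"
  define e :: "'a \<Rightarrow> bit" where "e = (\<lambda>x. if x \<in> S then 1 else 0)"
  have OG: "Orb \<subseteq> carrier G" by (auto simp: Orb_def)
  have sq: "x \<otimes> x \<in> Orb" if x: "x \<in> Orb" for x
  proof -
    obtain k where "x = g [^] (2 ^ k :: nat)" using x unfolding Orb_def by blast
    then have "x \<otimes> x = g [^] (2 ^ Suc k :: nat)" by (simp add: nat_pow_mult mult_2)
    then show ?thesis unfolding Orb_def by blast
  qed
  have SG: "S \<subseteq> carrier G" using OG by (auto simp: S_def)
  have "x \<otimes> x \<in> S" if "x \<in> S" for x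
    using that sq by (auto simp: S_def split: if_splits)
  then have e: "e \<in> carrier F2G" "e \<otimes>\<^bsub>F2G\<^esub> e = e"
    unfolding e_def using indicator_idempotent[OF SG] by blast+
  have "\<one> \<notin> Orb"
  proof
    assume "\<one> \<in> Orb"
    then obtain k where "\<one> = g [^] (2 ^ k :: nat)" unfolding Orb_def by blast
    then have "p dvd 2 ^ k" using pow_eq_id[OF g_closed, of "2 ^ k"] ord_g by simp
    then have "p dvd 2" by (rule prime_dvd_power[OF p_prime])
    then show False using p_gt_2 by (simp add: nat_dvd_not_less)
  qed
  have finO: "finite Orb" by (rule finite_subset[OF OG fin])
  have "odd (card S)" using \<open>\<one> \<notin> Orb\<close> finO by (simp add: S_def)
  moreover have "augmentation e = of_nat (card S)"
  proof -
    have "augmentation e = (\<Sum>x\<in>carrier G. e x)" by (rule augmentation_eq_sum[OF e(1)])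
    also have "\<dots> = (\<Sum>x\<in>S. 1)"
      by (rule sum.mono_neutral_cong_right[OF fin SG]) (auto simp: e_def)
    finally show ?thesis by simp
  qed
  ultimately have "augmentation e \<noteq> 0" by (metis even_of_nat_iff even_zero)
  moreover have "g \<in> Orb" unfolding Orb_def by (rule range_eqI[of _ _ 0]) simp
  then have "g \<in> S" by (simp add: S_def)
  then have "e \<noteq> \<one>\<^bsub>F2G\<^esub>"
    using g_neq_one by (auto simp: one_eq_group_elt fun_eq_iff group_elt_def e_def intro!: exI[of _ g])
  \<comment> \<open>The residue \<open>m\<close> missed by the powers of 2 shows that the support is not the whole group.\<close>
  moreover have "g [^] m \<noteq> \<one>" using m(1) pow_eq_id[OF g_closed] ord_g by simp
  then have "g [^] m \<notin> S" using m(2) by (auto simp: S_def Orb_def pow_g_eq_iff cong_sym_eq)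
  then have "e \<noteq> \<nu>"
    by (auto simp: fun_eq_iff norm_element_apply e_def intro!: exI[of _ "g [^] m"])
  ultimately show thesis using that e by blast
qed

section \<open>Units and roots of unity of order dividing p\<close>

text \<open>
  Since \<open>f\<close> equals its own power with exponent \<open>2 ^ (p - 1)\<close>, the power with exponent one less is an
  idempotent \<open>e\<close> with \<open>f e = f\<close>. If \<open>e\<close> is the identity, it exhibits an inverse of \<open>f\<close>; if it is the norm
  element, then \<open>f = f \<nu> = \<nu>\<close>.
\<close>

lemma unit_if_idempotents_trivial:
  assumes triv: "\<And>e. e \<in> carrier F2G \<Longrightarrow> e \<otimes>\<^bsub>F2G\<^esub> e = e \<Longrightarrow> augmentation e \<noteq> 0 \<Longrightarrow>
      e = \<one>\<^bsub>F2G\<^esub> \<or> e = \<nu>"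
    and f: "f \<in> carrier F2G" and aug: "augmentation f \<noteq> 0" and ne: "f \<noteq> \<nu>"
  shows "f \<in> Units F2G"
proof -
  obtain m where m: "(2::nat) ^ (p - 1) = Suc (Suc m)"
  proof -
    have "(2::nat) ^ (p - 1) \<ge> 2 ^ 1" using p_gt_2 by (intro power_increasing) auto
    then show thesis using that[of "2 ^ (p - 1) - 2"] by simp
  qed
  define e where "e = f [^]\<^bsub>F2G\<^esub> Suc m"
  have e: "e \<in> carrier F2G" by (simp add: e_def f del: R.nat_pow_Suc)
  have fe: "f \<otimes>\<^bsub>F2G\<^esub> e = f"
    using pow_two_power_p_minus_1[OF f] f unfolding m e_def
    by (simp add: R.m_comm)
  have "e = f \<otimes>\<^bsub>F2G\<^esub> f [^]\<^bsub>F2G\<^esub> m"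
    using f by (simp add: e_def R.m_comm)
  then have inv: "f \<otimes>\<^bsub>F2G\<^esub> f [^]\<^bsub>F2G\<^esub> m = e" ..
  have "e \<otimes>\<^bsub>F2G\<^esub> e = (f \<otimes>\<^bsub>F2G\<^esub> e) \<otimes>\<^bsub>F2G\<^esub> f [^]\<^bsub>F2G\<^esub> m"
    using f e unfolding inv[symmetric] by (simp add: R.m_ac)
  then have "e \<otimes>\<^bsub>F2G\<^esub> e = e" by (simp add: fe inv)
  moreover have "augmentation e = augmentation f ^ Suc m"
    unfolding e_def by (rule augmentation_pow[OF f])
  then have "augmentation e \<noteq> 0" using aug by simp
  ultimately consider "e = \<one>\<^bsub>F2G\<^esub>" | "e = \<nu>" using triv[OF e] by blast
  then show ?thesis
  proof cases
    case 1
    then show ?thesis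
      using f inv R.m_comm[OF f, of "f [^]\<^bsub>F2G\<^esub> m"] unfolding Units_def by force
  next
    case 2
    then show ?thesis using fe mult_norm[OF f] aug ne by simp
  qed
qed

text \<open>
  The geometric sum \<open>S\<close> of \<open>v\<close> satisfies \<open>v S = S\<close>, so \<open>(v + 1) S = 0\<close>. The element \<open>v + 1\<close> has augmentation 0
  and cannot be cancelled, but adding the norm element to it gives a unit \<open>w\<close>, and \<open>w S\<close> and \<open>w \<nu>\<close> are both \<open>\<nu>\<close>.
\<close>

lemma geometric_sum_eq_norm:
  assumes units: "\<And>f. f \<in> carrier F2G \<Longrightarrow> f \<noteq> \<nu> \<Longrightarrow> augmentation f \<noteq> 0 \<Longrightarrow> f \<in> Units F2G"
    and v: "v \<in> carrier F2G" "v [^]\<^bsub>F2G\<^esub> p = \<one>\<^bsub>F2G\<^esub>" "v \<noteq> \<one>\<^bsub>F2G\<^esub>"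
  shows "(\<lambda>z. \<Sum>i<p. (v [^]\<^bsub>F2G\<^esub> i) z) = \<nu>"
proof -
  define S where "S n = (\<lambda>z. \<Sum>i<n. (v [^]\<^bsub>F2G\<^esub> i) z)" for n :: nat
  have S: "S n \<in> carrier F2G" for n
    by (auto simp: carrier_iff S_def intro!: sum.neutral outside v)
  have S0: "S 0 = \<zero>\<^bsub>F2G\<^esub>" by (auto simp: S_def zero_apply)
  have SSuc: "S (Suc n) = S n \<oplus>\<^bsub>F2G\<^esub> v [^]\<^bsub>F2G\<^esub> n" for n
    by (rule ext) (simp add: S_def add_apply)
  have "v \<otimes>\<^bsub>F2G\<^esub> S n \<oplus>\<^bsub>F2G\<^esub> \<one>\<^bsub>F2G\<^esub> = S n \<oplus>\<^bsub>F2G\<^esub> v [^]\<^bsub>F2G\<^esub> n" for n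
  proof (induction n)
    case (Suc n)
    have "v \<otimes>\<^bsub>F2G\<^esub> S (Suc n) \<oplus>\<^bsub>F2G\<^esub> \<one>\<^bsub>F2G\<^esub> =
        (v \<otimes>\<^bsub>F2G\<^esub> S n \<oplus>\<^bsub>F2G\<^esub> \<one>\<^bsub>F2G\<^esub>) \<oplus>\<^bsub>F2G\<^esub> v [^]\<^bsub>F2G\<^esub> Suc n"
      using v S by (simp add: SSuc R.r_distr R.a_ac R.m_comm)
    then show ?case using Suc by (simp add: SSuc)
  qed (use v in \<open>simp add: S0\<close>)
  from this[of p] have "v \<otimes>\<^bsub>F2G\<^esub> S p \<oplus>\<^bsub>F2G\<^esub> \<one>\<^bsub>F2G\<^esub> = S p \<oplus>\<^bsub>F2G\<^esub> \<one>\<^bsub>F2G\<^esub>"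
    unfolding v(2) .
  then have vS: "v \<otimes>\<^bsub>F2G\<^esub> S p = S p"
    using R.add.right_cancel[OF R.one_closed R.m_closed[OF v(1) S] S] by simp
  have augv: "augmentation v = 1"
    using augmentation_pow[OF v(1), of p] p_gt_2 by (cases "augmentation v = 0") (auto simp: v(2) aug_one)
  have "augmentation (S p) = (\<Sum>z\<in>carrier G. \<Sum>i<p. (v [^]\<^bsub>F2G\<^esub> i) z)"
    unfolding augmentation_eq_sum[OF S] by (simp only: S_def)
  also have "\<dots> = (\<Sum>i<p. augmentation (v [^]\<^bsub>F2G\<^esub> i))"
    by (subst sum.swap) (simp only: augmentation_eq_sum R.nat_pow_closed v)
  also have "\<dots> = 1" by (simp add: augmentation_pow v augv of_nat_p_bit)
  finally have augS: "augmentation (S p) = 1" .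
  \<comment> \<open>A unit agreeing with \<open>v + 1\<close> up to the norm element.\<close>
  define w where "w = (v \<oplus>\<^bsub>F2G\<^esub> \<one>\<^bsub>F2G\<^esub>) \<oplus>\<^bsub>F2G\<^esub> \<nu>"
  have w: "w \<in> carrier F2G" by (simp add: w_def v)
  have augw: "augmentation w = 1"
    by (simp add: w_def augmentation_add v augv aug_one augmentation_norm)
  have "w \<noteq> \<nu>"
  proof
    assume "w = \<nu>"
    have "v z = \<one>\<^bsub>F2G\<^esub> z" for z
    proof -
      have "v z + \<one>\<^bsub>F2G\<^esub> z + \<nu> z = \<nu> z"
        using fun_cong[OF \<open>w = \<nu>\<close>, of z] by (simp only: w_def add_apply)
      then show ?thesis by (cases "v z = 0"; cases "\<one>\<^bsub>F2G\<^esub> z = 0"; cases "\<nu> z = 0") simp_all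
    qed
    then show False using v(3) by blast
  qed
  then have "w \<in> Units F2G" using units w augw by simp
  have "w \<otimes>\<^bsub>F2G\<^esub> S p = (S p \<oplus>\<^bsub>F2G\<^esub> S p) \<oplus>\<^bsub>F2G\<^esub> S p \<otimes>\<^bsub>F2G\<^esub> \<nu>"
    using S v by (simp add: w_def R.l_distr vS R.m_comm[OF norm_element_closed S])
  also have "\<dots> = \<nu>" using S by (simp add: add_self mult_norm augS)
  also have "\<dots> = w \<otimes>\<^bsub>F2G\<^esub> \<nu>" using w by (simp add: mult_norm augw)
  finally have "S p = \<nu>" using R.Units_l_cancel[OF \<open>w \<in> Units F2G\<close>] S by simp
  then show ?thesis by (simp add: S_def)
qed

text \<open>
  A substitute for bounding the roots of a polynomial in a field, by an orthogonality argument.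
  If \<open>u\<close> is not a group element, the geometric sum of \<open>u\<close> times the inverse of \<open>x\<close> is the norm element for
  every \<open>x\<close>. Its coefficient at \<open>z\<close> is the sum of the coefficients of \<open>u [^] i\<close> at \<open>z \<otimes> x [^] i\<close>. Adding up these
  ones over all \<open>x\<close> gives \<open>p\<close>, which is odd. In the other order of summation each exponent \<open>i > 0\<close> gives
  the augmentation 1 of \<open>u [^] i\<close>, and \<open>i = 0\<close> gives nothing when \<open>z\<close> is not the identity; the total
  \<open>p - 1\<close> is even.
\<close>

lemma pth_root_of_unity_is_group_elt:
  assumes units: "\<And>f. f \<in> carrier F2G \<Longrightarrow> f \<noteq> \<nu> \<Longrightarrow> augmentation f \<noteq> 0 \<Longrightarrow> f \<in> Units F2G"
    and u: "u \<in> carrier F2G" "u [^]\<^bsub>F2G\<^esub> p = \<one>\<^bsub>F2G\<^esub>"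
  shows "u \<in> group_elt ` carrier G"
proof (rule ccontr)
  assume no: "u \<notin> group_elt ` carrier G"
  \<comment> \<open>One coefficient of the geometric sum of \<open>u\<close> translated by the inverse of \<open>x\<close>.\<close>
  have one: "(\<Sum>i<p. (u [^]\<^bsub>F2G\<^esub> i) (z \<otimes> x [^] i)) = 1"
    if x: "x \<in> carrier G" and z: "z \<in> carrier G" for x z
  proof -
    let ?v = "u \<otimes>\<^bsub>F2G\<^esub> group_elt (inv x)"
    have pow: "?v [^]\<^bsub>F2G\<^esub> i = u [^]\<^bsub>F2G\<^esub> i \<otimes>\<^bsub>F2G\<^esub> group_elt (inv (x [^] i))" for i :: nat
      using u x by (simp add: R.nat_pow_distrib group_elt_pow nat_pow_inv)
    have "?v \<noteq> \<one>\<^bsub>F2G\<^esub>"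
    proof
      assume "?v = \<one>\<^bsub>F2G\<^esub>"
      then have "?v \<otimes>\<^bsub>F2G\<^esub> group_elt x = group_elt x" using x by simp
      then have "u = group_elt x"
        using u x by (simp add: R.m_assoc group_elt_mult flip: one_eq_group_elt)
      with no x show False by blast
    qed
    moreover have "?v [^]\<^bsub>F2G\<^esub> p = \<one>\<^bsub>F2G\<^esub>"
      unfolding pow using u x by (simp add: pow_p flip: one_eq_group_elt)
    ultimately have "(\<lambda>z. \<Sum>i<p. (?v [^]\<^bsub>F2G\<^esub> i) z) = \<nu>"
      using u x by (intro geometric_sum_eq_norm[OF units]) auto
    then have "(\<Sum>i<p. (?v [^]\<^bsub>F2G\<^esub> i) z) = \<nu> z" by metis
    then show ?thesis using x z u by (simp add: pow mult_group_elt_apply norm_element_apply)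
  qed
  have augu: "augmentation u = 1"
    using augmentation_pow[OF u(1), of p] p_gt_2 by (cases "augmentation u = 0") (auto simp: u(2) aug_one)
  \<comment> \<open>Evaluation at \<open>g\<close>, as a point other than the identity. For \<open>0 < i < p\<close> the map \<open>x \<mapsto> g \<otimes> x [^] i\<close> is a
    bijection of the group.\<close>
  have inner: "(\<Sum>x\<in>carrier G. (u [^]\<^bsub>F2G\<^esub> i) (g \<otimes> x [^] i)) = (if i = 0 then 0 else 1)"
    if i: "i < p" for i :: nat
  proof (cases "i = 0")
    case True
    then show ?thesis using g_neq_one by (simp add: one_eq_group_elt group_elt_def)
  next
    case False
    have "inj_on (\<lambda>x. g \<otimes> x [^] i) (carrier G)"
    proof (rule inj_onI)
      fix x y assume x: "x \<in> carrier G" and y: "y \<in> carrier G" and "g \<otimes> x [^] i = g \<otimes> y [^] i"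
      then have eq: "x [^] i = y [^] i" by simp
      obtain a b :: nat where ab: "x = g [^] a" "y = g [^] b"
        using obtain_pow_g x y by metis
      have "[a * i = b * i] (mod p)" using eq by (simp add: ab nat_pow_pow pow_g_eq_iff)
      moreover have "coprime i p"
        using False i p_prime by (metis coprime_commute gr0I nat_dvd_not_less prime_imp_coprime)
      ultimately have "[a = b] (mod p)" by (simp add: cong_mult_rcancel_nat)
      then show "x = y" by (simp add: ab pow_g_eq_iff)
    qed
    moreover from this have "(\<lambda>x. g \<otimes> x [^] i) ` carrier G = carrier G"
      by (intro endo_inj_surj fin) auto
    ultimately have "bij_betw (\<lambda>x. g \<otimes> x [^] i) (carrier G) (carrier G)"
      unfolding bij_betw_def by blast
    from sum.reindex_bij_betw[OF this, of "u [^]\<^bsub>F2G\<^esub> i"]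
    have "(\<Sum>x\<in>carrier G. (u [^]\<^bsub>F2G\<^esub> i) (g \<otimes> x [^] i)) = augmentation (u [^]\<^bsub>F2G\<^esub> i)"
      using u
      by (simp only: augmentation_eq_sum R.nat_pow_closed)
    then show ?thesis using False u by (simp add: augmentation_pow augu)
  qed
  have "(\<Sum>x\<in>carrier G. \<Sum>i<p. (u [^]\<^bsub>F2G\<^esub> i) (g \<otimes> x [^] i)) = (\<Sum>x\<in>carrier G. 1 :: bit)"
    by (intro sum.cong refl one) auto
  also have "\<dots> = 1" using order_eq of_nat_p_bit by (simp add: Coset.order_def)
  finally have "(\<Sum>i<p. \<Sum>x\<in>carrier G. (u [^]\<^bsub>F2G\<^esub> i) (g \<otimes> x [^] i)) = 1"
    by (subst sum.swap)
  moreover have "(\<Sum>i<p. \<Sum>x\<in>carrier G. (u [^]\<^bsub>F2G\<^esub> i) (g \<otimes> x [^] i)) =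
      (\<Sum>i<p. if i = 0 then 0 else 1)"
    by (intro sum.cong refl inner) simp
  moreover have "(\<Sum>i<p. if i = 0 then 0 else 1 :: bit) = (\<Sum>i\<in>{..<p} - {0}. 1)"
    by (rule sum.mono_neutral_cong_right) auto
  moreover have "(\<Sum>i\<in>{..<p} - {0}. 1 :: bit) = of_nat (p - 1)" using p_gt_2 by simp
  moreover have "(of_nat (p - 1) :: bit) = 0"
    using p_gt_2 of_nat_p_bit by (simp add: of_nat_diff)
  ultimately show False by simp
qed

text \<open>
  Any non-identity element generates the group, so the coefficients of \<open>f\<close> are all equal.
\<close>

lemma translation_invariant:
  assumes f: "f \<in> carrier F2G" and x: "x \<in> carrier G" "x \<noteq> \<one>"
    and inv: "f \<otimes>\<^bsub>F2G\<^esub> group_elt x = f"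
  shows "f = \<zero>\<^bsub>F2G\<^esub> \<or> f = \<nu>"
proof -
  interpret X: odd_prime_group G p x
    by unfold_locales (rule p_prime p_odd order_eq x)+
  have pow: "f \<otimes>\<^bsub>F2G\<^esub> group_elt (x [^] n) = f" for n :: nat
  proof (induction n)
    case (Suc n)
    then show ?case
      using f x inv by (simp add: group_elt_mult[symmetric] R.m_assoc[symmetric])
  qed (use f in \<open>simp add: one_eq_group_elt[symmetric]\<close>)
  have const: "f z = f \<one>" if z: "z \<in> carrier G" for z
  proof -
    obtain n :: nat where n: "z = x [^] n" using X.obtain_pow_g[OF z] by blast
    show ?thesis using pow[of n] mult_group_elt_apply[OF f z z] z unfolding n[symmetric] by simp
  qed
  show ?thesis
  proof (cases "f \<one> = 0")
    case True
    have "f = \<zero>\<^bsub>F2G\<^esub>"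
    proof (intro KG_eqI f R.zero_closed)
      fix z assume "z \<in> carrier G"
      then have "f z = f \<one>" by (rule const)
      then show "f z = \<zero>\<^bsub>F2G\<^esub> z" unfolding True zero_apply .
    qed
    then show ?thesis ..
  next
    case False
    have "f = \<nu>"
    proof (intro KG_eqI f norm_element_closed)
      fix z assume z: "z \<in> carrier G"
      then have "f z = f \<one>" by (rule const)
      with False have "f z \<noteq> 0" by metis
      then show "f z = \<nu> z" using z by (simp add: norm_element_apply)
    qed
    then show ?thesis ..
  qed
qed

lemma idempotent_unit:
  assumes "e \<in> Units F2G" "e \<otimes>\<^bsub>F2G\<^esub> e = e"
  shows "e = \<one>\<^bsub>F2G\<^esub>"
proof -
  have e: "e \<in> carrier F2G" by (rule R.Units_closed[OF assms(1)])
  have "e \<otimes>\<^bsub>F2G\<^esub> e = e \<otimes>\<^bsub>F2G\<^esub> \<one>\<^bsub>F2G\<^esub>" unfolding assms(2) using e by simp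
  then show ?thesis using R.Units_l_cancel[OF assms(1) e R.one_closed] by blast
qed

text \<open>
  The idempotent splits the algebra into two factors; take \<open>g\<close> in one factor and the identity in the
  other. Its \<open>p\<close>-th power is the identity. Were it a group element \<open>h\<close>, comparison in the two factors would make
  one of the two complementary idempotents invariant under a nontrivial translation, hence trivial.
\<close>

lemma exotic_pth_root_of_unity:
  assumes e: "e \<in> carrier F2G" "e \<otimes>\<^bsub>F2G\<^esub> e = e" "augmentation e \<noteq> 0" "e \<noteq> \<one>\<^bsub>F2G\<^esub>" "e \<noteq> \<nu>"
  obtains u where "u \<in> carrier F2G" "u [^]\<^bsub>F2G\<^esub> p = \<one>\<^bsub>F2G\<^esub>" "u \<notin> group_elt ` carrier G"
proof -
  define f where "f = \<one>\<^bsub>F2G\<^esub> \<oplus>\<^bsub>F2G\<^esub> e"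
  have f: "f \<in> carrier F2G" by (simp add: f_def e)
  have ef: "e \<otimes>\<^bsub>F2G\<^esub> f = \<zero>\<^bsub>F2G\<^esub>" using e by (simp add: f_def R.r_distr add_self)
  have ff: "f \<otimes>\<^bsub>F2G\<^esub> f = f"
  proof -
    have "f \<otimes>\<^bsub>F2G\<^esub> f = f \<oplus>\<^bsub>F2G\<^esub> e \<otimes>\<^bsub>F2G\<^esub> f"
      using e f by (subst f_def) (simp add: R.l_distr)
    then show ?thesis using f by (simp add: ef)
  qed
  have ef1: "e \<oplus>\<^bsub>F2G\<^esub> f = \<one>\<^bsub>F2G\<^esub>"
    unfolding f_def using e R.a_lcomm[OF e(1) R.one_closed e(1)] by (simp add: add_self)
  have augf: "augmentation f = 0" using e by (simp add: f_def augmentation_add aug_one)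
  define u where "u = e \<otimes>\<^bsub>F2G\<^esub> group_elt g \<oplus>\<^bsub>F2G\<^esub> f"
  have u: "u \<in> carrier F2G" by (simp add: u_def e f)
  have eu: "e \<otimes>\<^bsub>F2G\<^esub> u = e \<otimes>\<^bsub>F2G\<^esub> group_elt g"
    using e f by (simp add: u_def R.r_distr ef R.m_assoc[symmetric])
  have fu: "f \<otimes>\<^bsub>F2G\<^esub> u = f"
    using e f ef by (simp add: u_def R.r_distr ff R.m_assoc[symmetric] R.m_comm[OF f e(1)])
  have eupow: "e \<otimes>\<^bsub>F2G\<^esub> u [^]\<^bsub>F2G\<^esub> n = e \<otimes>\<^bsub>F2G\<^esub> group_elt (g [^] n)" for n :: nat
  proof (induction n)
    case (Suc n)
    have "e \<otimes>\<^bsub>F2G\<^esub> u [^]\<^bsub>F2G\<^esub> Suc n = (e \<otimes>\<^bsub>F2G\<^esub> u [^]\<^bsub>F2G\<^esub> n) \<otimes>\<^bsub>F2G\<^esub> u"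
      using e u by (simp add: R.m_assoc)
    also have "\<dots> = (e \<otimes>\<^bsub>F2G\<^esub> u) \<otimes>\<^bsub>F2G\<^esub> group_elt (g [^] n)"
      unfolding Suc using e u by (simp add: R.m_ac)
    also have "\<dots> = e \<otimes>\<^bsub>F2G\<^esub> group_elt (g [^] Suc n)"
      unfolding eu using e by (simp add: R.m_assoc group_elt_mult m_comm)
    finally show ?case .
  qed (simp add: one_eq_group_elt)
  have fupow: "f \<otimes>\<^bsub>F2G\<^esub> u [^]\<^bsub>F2G\<^esub> n = f" for n :: nat
  proof (induction n)
    case (Suc n)
    then show ?case using f u fu by (simp add: R.m_assoc[symmetric])
  qed (use f in simp)
  have "u [^]\<^bsub>F2G\<^esub> p = (e \<oplus>\<^bsub>F2G\<^esub> f) \<otimes>\<^bsub>F2G\<^esub> u [^]\<^bsub>F2G\<^esub> p" using u by (simp add: ef1)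
  also have "\<dots> = e \<otimes>\<^bsub>F2G\<^esub> group_elt \<one> \<oplus>\<^bsub>F2G\<^esub> f"
    using e f u by (simp add: R.l_distr eupow fupow pow_p)
  also have "\<dots> = \<one>\<^bsub>F2G\<^esub>" using e by (simp add: ef1 flip: one_eq_group_elt)
  finally have up: "u [^]\<^bsub>F2G\<^esub> p = \<one>\<^bsub>F2G\<^esub>" .
  have "u \<noteq> group_elt h" if h: "h \<in> carrier G" for h
  proof
    assume uh: "u = group_elt h"
    show False
    proof (cases "h = \<one>")
      case True
      then have "e \<otimes>\<^bsub>F2G\<^esub> group_elt g = e" using eu e by (simp add: uh flip: one_eq_group_elt)
      then have "e = \<zero>\<^bsub>F2G\<^esub> \<or> e = \<nu>" by (intro translation_invariant[OF e(1) g_closed g_neq_one])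
      then show False using e by (auto simp: augmentation_def zero_apply)
    next
      case False
      have "f \<otimes>\<^bsub>F2G\<^esub> group_elt h = f" using fu by (simp add: uh)
      then have "f = \<zero>\<^bsub>F2G\<^esub> \<or> f = \<nu>" by (intro translation_invariant[OF f h False])
      then have "f = \<zero>\<^bsub>F2G\<^esub>" using augf augmentation_norm by auto
      then have "e = \<one>\<^bsub>F2G\<^esub>" using ef1 e by simp
      then show False using e(4) by simp
    qed
  qed
  then show thesis using that[OF u up] by blast
qed

theorem primitive_root_iff_units:
  "primitive_root_mod p 2 \<longleftrightarrow>
    (\<forall>f\<in>carrier F2G. f \<noteq> \<nu> \<and> augmentation f \<noteq> 0 \<longrightarrow> f \<in> Units F2G)"
proof
  assume "primitive_root_mod p 2"
  then show "\<forall>f\<in>carrier F2G. f \<noteq> \<nu> \<and> augmentation f \<noteq> 0 \<longrightarrow> f \<in> Units F2G"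
    by (intro ballI impI unit_if_idempotents_trivial augmentation_one_idempotent_trivial) auto
next
  assume *: "\<forall>f\<in>carrier F2G. f \<noteq> \<nu> \<and> augmentation f \<noteq> 0 \<longrightarrow> f \<in> Units F2G"
  show "primitive_root_mod p 2"
  proof (rule ccontr)
    assume "\<not> primitive_root_mod p 2"
    then obtain e where e: "e \<in> carrier F2G" "e \<otimes>\<^bsub>F2G\<^esub> e = e" "augmentation e \<noteq> 0"
        "e \<noteq> \<one>\<^bsub>F2G\<^esub>" "e \<noteq> \<nu>"
      by (rule nontrivial_idempotent)
    then have "e \<in> Units F2G" using * by blast
    then show False using idempotent_unit e(2,4) by blast
  qed
qed

theorem primitive_root_iff_roots_of_unity:
  "primitive_root_mod p 2 \<longleftrightarrow>
    (\<forall>u\<in>carrier F2G. u [^]\<^bsub>F2G\<^esub> p = \<one>\<^bsub>F2G\<^esub> \<longrightarrow> u \<in> group_elt ` carrier G)"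
proof
  assume "primitive_root_mod p 2"
  then show "\<forall>u\<in>carrier F2G. u [^]\<^bsub>F2G\<^esub> p = \<one>\<^bsub>F2G\<^esub> \<longrightarrow> u \<in> group_elt ` carrier G"
    unfolding primitive_root_iff_units by (intro ballI impI pth_root_of_unity_is_group_elt) auto
next
  assume *: "\<forall>u\<in>carrier F2G. u [^]\<^bsub>F2G\<^esub> p = \<one>\<^bsub>F2G\<^esub> \<longrightarrow> u \<in> group_elt ` carrier G"
  show "primitive_root_mod p 2"
  proof (rule ccontr)
    assume "\<not> primitive_root_mod p 2"
    then obtain e where "e \<in> carrier F2G" "e \<otimes>\<^bsub>F2G\<^esub> e = e" "augmentation e \<noteq> 0"
        "e \<noteq> \<one>\<^bsub>F2G\<^esub>" "e \<noteq> \<nu>"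
      by (rule nontrivial_idempotent)
    then obtain u where "u \<in> carrier F2G" "u [^]\<^bsub>F2G\<^esub> p = \<one>\<^bsub>F2G\<^esub>" "u \<notin> group_elt ` carrier G"
      by (rule exotic_pth_root_of_unity)
    with * show False by blast
  qed
qed

section \<open>Counting units and units of order p\<close>

lemma bij_betw_support: "bij_betw (\<lambda>f. {x. f x \<noteq> 0}) (carrier F2G) (Pow (carrier G))"
proof (rule bij_betw_byWitness[where f' = "\<lambda>S x. if x \<in> S then 1 else 0"])
  show "\<forall>f\<in>carrier F2G. (\<lambda>x. if x \<in> {x. f x \<noteq> 0} then 1 else 0) = f"
    by (auto simp: fun_eq_iff)
  show "(\<lambda>f. {x. f x \<noteq> 0}) ` carrier F2G \<subseteq> Pow (carrier G)"
    using outside by blast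
qed (auto simp: carrier_iff)

lemma finite_F2G: "finite (carrier F2G)" and card_F2G: "card (carrier F2G) = 2 ^ p"
  using bij_betw_finite[OF bij_betw_support] bij_betw_same_card[OF bij_betw_support] fin order_eq
  by (simp_all add: card_Pow Coset.order_def)

lemma augmentation_eq_card: "f \<in> carrier F2G \<Longrightarrow> augmentation f = of_nat (card {x. f x \<noteq> 0})"
  unfolding augmentation_def by simp

text \<open>
  Adding the norm element exchanges the two values of the augmentation.
\<close>

lemma card_augmentation_one: "card {f \<in> carrier F2G. augmentation f \<noteq> 0} = 2 ^ (p - 1)"
proof -
  let ?A = "{f \<in> carrier F2G. augmentation f \<noteq> 0}" and ?B = "{f \<in> carrier F2G. augmentation f = 0}"
  have invol: "(f \<oplus>\<^bsub>F2G\<^esub> \<nu>) \<oplus>\<^bsub>F2G\<^esub> \<nu> = f" if "f \<in> carrier F2G" for f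
    using that by (simp add: R.a_assoc add_self)
  have "bij_betw (\<lambda>f. f \<oplus>\<^bsub>F2G\<^esub> \<nu>) ?A ?B"
    by (rule bij_betw_byWitness[where f' = "\<lambda>f. f \<oplus>\<^bsub>F2G\<^esub> \<nu>"])
      (auto simp: invol augmentation_add augmentation_norm)
  then have "card ?A = card ?B" by (rule bij_betw_same_card)
  moreover have "card ?A + card ?B = card (?A \<union> ?B)"
    using finite_F2G by (intro card_Un_disjoint[symmetric]) auto
  moreover have "?A \<union> ?B = carrier F2G" by auto
  moreover have "(2::nat) ^ p = 2 * 2 ^ (p - 1)"
    using p_gt_2 by (cases p) auto
  ultimately show ?thesis using card_F2G by simp
qed

lemma Units_subset: "Units F2G \<subseteq> {f \<in> carrier F2G. augmentation f \<noteq> 0} - {\<nu>}"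
proof
  fix f assume f: "f \<in> Units F2G"
  then have fc: "f \<in> carrier F2G" by (rule R.Units_closed)
  obtain h where h: "h \<in> carrier F2G" "f \<otimes>\<^bsub>F2G\<^esub> h = \<one>\<^bsub>F2G\<^esub>"
    using f unfolding Units_def by blast
  have "augmentation f * augmentation h = 1"
    unfolding augmentation_mult[OF fc h(1), symmetric] h(2) by (rule aug_one)
  then have "augmentation f \<noteq> 0" by auto
  moreover have "f \<noteq> \<nu>"
  proof
    assume "f = \<nu>"
    then have "\<nu> = \<one>\<^bsub>F2G\<^esub>"
      using idempotent_unit[of \<nu>] f by (simp add: mult_norm augmentation_norm)
    then have "\<nu> g = \<one>\<^bsub>F2G\<^esub> g" by simp
    then show False using g_neq_one by (simp add: norm_element_apply one_eq_group_elt group_elt_def)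
  qed
  ultimately show "f \<in> {f \<in> carrier F2G. augmentation f \<noteq> 0} - {\<nu>}" using fc by blast
qed

text \<open>
  Units have augmentation 1 and differ from the norm element, and exactly \<open>2 ^ (p - 1) - 1\<close> elements meet
  these two conditions. So the count says that they are also sufficient for being a unit.
\<close>

theorem primitive_root_iff_card_Units:
  "primitive_root_mod p 2 \<longleftrightarrow> card (Units F2G) = 2 ^ (p - 1) - 1"
proof -
  define A where "A = {f \<in> carrier F2G. augmentation f \<noteq> 0} - {\<nu>}"
  have finA: "finite A" unfolding A_def using finite_F2G by simp
  have cardA: "card A = 2 ^ (p - 1) - 1"
    unfolding A_def using card_augmentation_one
    by (subst card_Diff_singleton) (simp_all add: augmentation_norm)
  have sub: "Units F2G \<subseteq> A" unfolding A_def by (rule Units_subset)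
  have "primitive_root_mod p 2 \<longleftrightarrow> A \<subseteq> Units F2G"
    unfolding primitive_root_iff_units A_def by auto
  also have "\<dots> \<longleftrightarrow> card (Units F2G) = card A"
  proof
    assume "A \<subseteq> Units F2G"
    with sub have "Units F2G = A" by (rule subset_antisym)
    then show "card (Units F2G) = card A" by (rule arg_cong)
  next
    assume "card (Units F2G) = card A"
    then have "Units F2G = A" by (rule card_subset_eq[OF finA sub])
    then show "A \<subseteq> Units F2G" by (rule equalityD2)
  qed
  finally show ?thesis unfolding cardA .
qed

lemma pth_root_of_unity_Units:
  assumes "u \<in> carrier F2G" "u [^]\<^bsub>F2G\<^esub> p = \<one>\<^bsub>F2G\<^esub>"
  shows "u \<in> Units F2G"
proof -
  obtain n where n: "p = Suc n" using p_gt_2 by (cases p) auto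
  have "u [^]\<^bsub>F2G\<^esub> n \<otimes>\<^bsub>F2G\<^esub> u = \<one>\<^bsub>F2G\<^esub>" using assms(2) unfolding n by simp
  moreover have "u \<otimes>\<^bsub>F2G\<^esub> u [^]\<^bsub>F2G\<^esub> n = u [^]\<^bsub>F2G\<^esub> n \<otimes>\<^bsub>F2G\<^esub> u"
    using assms(1) by (intro R.m_comm) auto
  moreover have "u [^]\<^bsub>F2G\<^esub> n \<in> carrier F2G" using assms(1) by simp
  ultimately show ?thesis unfolding Units_def using assms(1) by auto
qed

lemma group_elt_pow_p: "x \<in> carrier G \<Longrightarrow> group_elt x [^]\<^bsub>F2G\<^esub> p = \<one>\<^bsub>F2G\<^esub>"
  by (simp add: group_elt_pow pow_p one_eq_group_elt)

theorem primitive_root_iff_units_of_order_p: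
  "primitive_root_mod p 2 \<longleftrightarrow>
    {u \<in> Units F2G. group.ord (units_of F2G) u = p} = group_elt ` (carrier G - {\<one>})"
proof -
  interpret U: group "units_of F2G" by (rule R.units_group)
  have ord: "U.ord u = p \<longleftrightarrow> u [^]\<^bsub>F2G\<^esub> p = \<one>\<^bsub>F2G\<^esub> \<and> u \<noteq> \<one>\<^bsub>F2G\<^esub>" if u: "u \<in> Units F2G" for u
  proof -
    have uc: "u \<in> carrier (units_of F2G)" using u by (simp add: units_of_carrier)
    have "U.ord u = p \<longleftrightarrow> U.ord u dvd p \<and> U.ord u \<noteq> 1"
      using p_prime by (auto simp: prime_nat_iff)
    also have "U.ord u dvd p \<longleftrightarrow> u [^]\<^bsub>F2G\<^esub> p = \<one>\<^bsub>F2G\<^esub>"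
      using U.pow_eq_id[OF uc, of p] u by (simp add: R.units_of_pow units_of_one)
    also have "U.ord u \<noteq> 1 \<longleftrightarrow> u \<noteq> \<one>\<^bsub>F2G\<^esub>"
      using U.ord_eq_1[OF uc] by (simp add: units_of_one)
    finally show ?thesis .
  qed
  have "{u \<in> Units F2G. U.ord u = p} = {u \<in> carrier F2G. u [^]\<^bsub>F2G\<^esub> p = \<one>\<^bsub>F2G\<^esub>} - {\<one>\<^bsub>F2G\<^esub>}"
    using ord pth_root_of_unity_Units R.Units_closed by blast
  also have "\<dots> = group_elt ` (carrier G - {\<one>}) \<longleftrightarrow>
      {u \<in> carrier F2G. u [^]\<^bsub>F2G\<^esub> p = \<one>\<^bsub>F2G\<^esub>} \<subseteq> group_elt ` carrier G"
    using group_elt_pow_p unfolding one_eq_group_elt by (auto simp: group_elt_inj)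
  also have "\<dots> \<longleftrightarrow> primitive_root_mod p 2"
    unfolding primitive_root_iff_roots_of_unity by blast
  finally show ?thesis ..
qed

end

section \<open>Circulant matrices\<close>

lemma circulant_mat_iff:
  "circulant n (mat n n f) \<longleftrightarrow> (\<forall>i<n. \<forall>j. Suc j < n \<longrightarrow> f (i, Suc j) = f ((i + n - 1) mod n, j))"
proof -
  have "col (mat n n f) (Suc j) = rotate_down (col (mat n n f) j) \<longleftrightarrow>
      (\<forall>i<n. f (i, Suc j) = f ((i + n - 1) mod n, j))" if "Suc j < n" for j
    using that by (auto simp: vec_eq_iff rotate_down_def)
  then show ?thesis unfolding circulant_def by auto
qed

context odd_prime_group begin

text \<open>
  The matrix of multiplication by \<open>f\<close> in the basis of powers of \<open>g\<close>; see \<open>circ_mult\<close> and \<open>bij_betw_circ\<close>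
  for the resulting isomorphism with the circulant matrices.
\<close>

definition circ :: "('a \<Rightarrow> 'k) \<Rightarrow> 'k mat" where
  "circ f = mat p p (\<lambda>(i, j). f (g [^] i \<otimes> inv (g [^] j)))"

lemma circ_carrier [simp]: "circ f \<in> carrier_mat p p"
  by (simp add: circ_def)

lemma dim_circ [simp]: "dim_row (circ f) = p" "dim_col (circ f) = p"
  by (simp_all add: circ_def)

lemma circ_index: "i < p \<Longrightarrow> j < p \<Longrightarrow> circ f $$ (i, j) = f (g [^] i \<otimes> inv (g [^] j))"
  by (simp add: circ_def)

lemma circulant_circ: "circulant p (circ f)"
  unfolding circ_def circulant_mat_iff
proof (intro allI impI)
  fix i j assume i: "i < p" and j: "Suc j < p"
  have "[(i + p - 1) mod p + 1 = i] (mod p)"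
    using p_gt_2 by (simp add: cong_def mod_simps)
  then have "g [^] ((i + p - 1) mod p) \<otimes> g = g [^] i"
    using pow_g_eq_iff[of "(i + p - 1) mod p + 1" i] by simp
  then have "g [^] i \<otimes> inv (g [^] Suc j) = g [^] ((i + p - 1) mod p) \<otimes> (g \<otimes> inv (g [^] j \<otimes> g))"
    by (simp add: m_assoc[symmetric])
  also have "g \<otimes> inv (g [^] j \<otimes> g) = inv (g [^] j)"
    by (simp add: inv_mult_group m_assoc[symmetric])
  finally show "(case (i, Suc j) of (i, j) \<Rightarrow> f (g [^] i \<otimes> inv (g [^] j))) =
      (case ((i + p - 1) mod p, j) of (i, j) \<Rightarrow> f (g [^] i \<otimes> inv (g [^] j)))" by simp
qed

lemma circulant_eqI:
  assumes A: "circulant n A" and B: "circulant n B" and col0: "\<And>i. i < n \<Longrightarrow> A $$ (i, 0) = B $$ (i, 0)"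
  shows "A = B"
proof -
  have Ac: "A \<in> carrier_mat n n" and Bc: "B \<in> carrier_mat n n"
    using A B by (auto simp: circulant_def)
  have col: "col A j = col B j" if "j < n" for j
    using that
  proof (induction j)
    case 0
    then show ?case using Ac Bc col0 by (intro eq_vecI) auto
  next
    case (Suc j)
    then show ?case using A B by (simp add: circulant_def)
  qed
  show ?thesis
  proof (rule eq_matI)
    fix i j assume "i < dim_row B" "j < dim_col B"
    then show "A $$ (i, j) = B $$ (i, j)"
      using col[of j] Ac Bc by (metis carrier_matD index_col)
  qed (use Ac Bc in auto)
qed

lemma bij_betw_circ: "bij_betw circ (carrier F2G) {A. circulant p A}"
  unfolding bij_betw_def
proof
  show "inj_on circ (carrier F2G)"
  proof (rule inj_onI)
    fix f h assume f: "f \<in> carrier F2G" and h: "h \<in> carrier F2G" and eq: "circ f = circ h"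
    show "f = h"
    proof (rule KG_eqI[OF f h])
      fix x assume "x \<in> carrier G"
      then obtain i where i: "i < p" "x = g [^] i" by (rule obtain_pow_g)
      then show "f x = h x"
        using circ_index[of i 0 f] circ_index[of i 0 h] eq p_gt_2 by simp
    qed
  qed
  show "circ ` carrier F2G = {A. circulant p A}"
  proof (intro equalityI subsetI)
    fix A :: "bit mat" assume "A \<in> {A. circulant p A}"
    then have A: "circulant p A" by simp
    define f where "f x = (if x \<in> carrier G then A $$ (the_inv_into {..<p} (\<lambda>i. g [^] i) x, 0) else 0)" for x
    have "A = circ f"
    proof (rule circulant_eqI[OF A circulant_circ])
      fix i assume i: "i < p"
      then have "the_inv_into {..<p} (\<lambda>i::nat. g [^] i) (g [^] i) = i"
        using bij_betw_pow_g by (intro the_inv_into_f_f) (auto simp: bij_betw_def)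
      then show "A $$ (i, 0) = circ f $$ (i, 0)"
        using i p_gt_2 by (simp add: circ_index f_def)
    qed
    moreover have "f \<in> carrier F2G" by (simp add: carrier_iff f_def)
    ultimately show "A \<in> circ ` carrier F2G" by blast
  qed (auto simp: circulant_circ)
qed

lemma sum_pow_g: "(\<Sum>k<p. F (g [^] k)) = (\<Sum>x\<in>carrier G. F x)"
  by (rule sum.reindex_bij_betw[OF bij_betw_pow_g])

lemma circ_mult:
  assumes f: "f \<in> carrier F2G" and h: "h \<in> carrier F2G"
  shows "circ (f \<otimes>\<^bsub>F2G\<^esub> h) = circ f * circ h"
proof (rule eq_matI)
  fix i j assume "i < dim_row (circ f * circ h)" "j < dim_col (circ f * circ h)"
  then have i: "i < p" and j: "j < p" by (simp_all add: circ_def)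
  let ?a = "g [^] i" and ?b = "g [^] j"
  have "bij_betw (\<lambda>x. x \<otimes> inv ?b) (carrier G) (carrier G)"
    by (rule bij_betw_byWitness[where f' = "\<lambda>x. x \<otimes> ?b"]) (auto simp: m_assoc)
  then have "(\<Sum>y\<in>carrier G. f (?a \<otimes> inv ?b \<otimes> inv y) * h y) =
      (\<Sum>x\<in>carrier G. f (?a \<otimes> inv ?b \<otimes> inv (x \<otimes> inv ?b)) * h (x \<otimes> inv ?b))"
    by (rule sum.reindex_bij_betw[symmetric])
  also have "\<dots> = (\<Sum>x\<in>carrier G. f (?a \<otimes> inv x) * h (x \<otimes> inv ?b))"
    by (intro sum.cong refl) (simp add: inv_mult m_ac)
  also have "\<dots> = (\<Sum>k<p. f (?a \<otimes> inv (g [^] k)) * h (g [^] k \<otimes> inv ?b))"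
    by (rule sum_pow_g[symmetric])
  also have "\<dots> = (\<Sum>k<p. circ f $$ (i, k) * circ h $$ (k, j))"
    by (intro sum.cong refl) (simp add: circ_index i j)
  also have "\<dots> = (circ f * circ h) $$ (i, j)"
    using i j by (simp add: circ_def scalar_prod_def atLeast0LessThan)
  finally show "circ (f \<otimes>\<^bsub>F2G\<^esub> h) $$ (i, j) = (circ f * circ h) $$ (i, j)"
    by (simp add: circ_index i j mult_apply f h)
qed (simp_all add: circ_def)

lemma circ_one: "circ \<one>\<^bsub>F2G\<^esub> = 1\<^sub>m p"
proof (rule eq_matI)
  fix i j assume "i < dim_row (1\<^sub>m p)" "j < dim_col (1\<^sub>m p)"
  then have i: "i < p" and j: "j < p" by simp_all
  have "g [^] i \<otimes> inv (g [^] j) = \<one> \<longleftrightarrow> g [^] i = g [^] j"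
    by (metis g_closed inv_closed inv_equality inv_inv nat_pow_closed r_inv)
  also have "\<dots> \<longleftrightarrow> i = j" using i j by (simp add: pow_g_eq_iff cong_def)
  finally show "circ \<one>\<^bsub>F2G\<^esub> $$ (i, j) = 1\<^sub>m p $$ (i, j)"
    using i j by (simp add: circ_index one_eq_group_elt group_elt_def)
qed (simp_all add: circ_def)

lemma circ_pow: "f \<in> carrier F2G \<Longrightarrow> circ f ^\<^sub>m n = circ (f [^]\<^bsub>F2G\<^esub> n)"
proof (induction n)
  case 0
  then show ?case by (simp add: circ_one)
next
  case (Suc n)
  then show ?case by (simp add: circ_mult)
qed

text \<open>
  The first column of an inverse matrix, read as an element of the algebra, is an inverse of \<open>f\<close>,
  whatever the other columns are.
\<close>

lemma invertible_circ_iff: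
  assumes f: "f \<in> carrier F2G"
  shows "invertible_mat (circ f) \<longleftrightarrow> f \<in> Units F2G"
proof
  assume "f \<in> Units F2G"
  then obtain h where h: "h \<in> carrier F2G" "f \<otimes>\<^bsub>F2G\<^esub> h = \<one>\<^bsub>F2G\<^esub>" "h \<otimes>\<^bsub>F2G\<^esub> f = \<one>\<^bsub>F2G\<^esub>"
    unfolding Units_def by blast
  have "circ f * circ h = 1\<^sub>m p" "circ h * circ f = 1\<^sub>m p"
    using h f by (simp_all add: circ_mult[symmetric] circ_one)
  then show "invertible_mat (circ f)"
    unfolding invertible_mat_def inverts_mat_def by (auto simp: circ_def)
next
  assume "invertible_mat (circ f)"
  then obtain B where "circ f * B = 1\<^sub>m p" and BA: "B * circ f = 1\<^sub>m (dim_row B)"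
    unfolding invertible_mat_def inverts_mat_def by (auto simp: circ_def)
  then have AB: "(circ f * B) $$ (i, 0) = 1\<^sub>m p $$ (i, 0)" for i by simp
  have Bc: "dim_row B = p" using arg_cong[OF BA, of dim_col] by (simp add: circ_def)
  have Bd: "dim_col B = p" using arg_cong[OF \<open>circ f * B = 1\<^sub>m p\<close>, of dim_col] by simp
  \<comment> \<open>The first column of the inverse, transported to the group along the powers of \<open>g\<close>.\<close>
  define b where "b x = (if x \<in> carrier G then B $$ (the_inv_into {..<p} (\<lambda>i. g [^] i) x, 0) else 0)" for x
  have bpow: "b (g [^] i) = B $$ (i, 0)" if "i < p" for i
  proof -
    have "the_inv_into {..<p} (\<lambda>i::nat. g [^] i) (g [^] i) = i"
      using bij_betw_pow_g that by (intro the_inv_into_f_f) (auto simp: bij_betw_def)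
    then show ?thesis by (simp add: b_def)
  qed
  have b: "b \<in> carrier F2G" by (simp add: carrier_iff b_def)
  have "f \<otimes>\<^bsub>F2G\<^esub> b = \<one>\<^bsub>F2G\<^esub>"
  proof (rule KG_eqI)
    fix x assume "x \<in> carrier G"
    then obtain i where i: "i < p" "x = g [^] i" by (rule obtain_pow_g)
    have "(f \<otimes>\<^bsub>F2G\<^esub> b) x = (\<Sum>y\<in>carrier G. f (x \<otimes> inv y) * b y)"
      unfolding i by (rule mult_apply[OF f b]) simp
    also have "\<dots> = (\<Sum>k<p. f (x \<otimes> inv (g [^] k)) * b (g [^] k))"
      by (rule sum_pow_g[symmetric])
    also have "\<dots> = (\<Sum>k<p. circ f $$ (i, k) * B $$ (k, 0))"
      by (intro sum.cong refl) (simp add: i circ_index bpow)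
    also have "\<dots> = (circ f * B) $$ (i, 0)"
      using i p_gt_2 Bc Bd by (simp add: circ_def scalar_prod_def atLeast0LessThan)
    also have "\<dots> = circ \<one>\<^bsub>F2G\<^esub> $$ (i, 0)" unfolding AB circ_one ..
    also have "\<dots> = \<one>\<^bsub>F2G\<^esub> x" using i p_gt_2 by (simp add: circ_index)
    finally show "(f \<otimes>\<^bsub>F2G\<^esub> b) x = \<one>\<^bsub>F2G\<^esub> x" .
  qed (use f b in simp_all)
  then show "f \<in> Units F2G" using f b R.m_comm[OF f b] unfolding Units_def by auto
qed

lemma circ_norm: "circ \<nu> = mat p p (\<lambda>_. 1)"
  by (rule eq_matI) (auto simp: circ_def norm_element_apply)

lemma circ_eq_iff: "f \<in> carrier F2G \<Longrightarrow> h \<in> carrier F2G \<Longrightarrow> circ f = circ h \<longleftrightarrow> f = h"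
  using bij_betw_circ unfolding bij_betw_def inj_on_def by blast

lemma all_ones_in_kernel_circ_iff:
  assumes f: "f \<in> carrier F2G"
  shows "vec p (\<lambda>_. 1) \<in> mat_kernel (circ f) \<longleftrightarrow> augmentation f = 0"
proof -
  have "circ f *\<^sub>v vec p (\<lambda>_. 1) = vec p (\<lambda>_. augmentation f)"
  proof (rule eq_vecI)
    fix i assume "i < dim_vec (vec p (\<lambda>_. augmentation f))"
    then have i: "i < p" by simp
    then have "(circ f *\<^sub>v vec p (\<lambda>_. 1)) $ i = row (circ f) i \<bullet> vec p (\<lambda>_. 1)"
      by (simp add: circ_def)
    also have "\<dots> = (\<Sum>k\<in>{0..<p}. row (circ f) i $ k * vec p (\<lambda>_. 1) $ k)"
      by (simp only: scalar_prod_def dim_vec)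
    also have "\<dots> = (\<Sum>k<p. f (g [^] i \<otimes> inv (g [^] k)) * \<nu> (g [^] k))"
      by (intro sum.cong) (auto simp: circ_def i norm_element_apply)
    also have "\<dots> = (\<Sum>x\<in>carrier G. f (g [^] i \<otimes> inv x) * \<nu> x)"
      by (rule sum_pow_g)
    also have "\<dots> = (f \<otimes>\<^bsub>F2G\<^esub> \<nu>) (g [^] i)"
      by (rule mult_apply[symmetric]) (simp_all add: f)
    also have "\<dots> = augmentation f"
      by (rule mult_norm_element_apply) (simp_all add: f)
    finally show "(circ f *\<^sub>v vec p (\<lambda>_. 1)) $ i = vec p (\<lambda>_. augmentation f) $ i"
      using i by simp
  qed (simp add: circ_def)
  then show ?thesis
    using p_gt_2 by (auto simp: mat_kernel_def circ_def vec_eq_iff)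
qed

lemma matrix_order_circ_dvd_iff:
  assumes f: "f \<in> carrier F2G" "f \<in> Units F2G"
  shows "matrix_order p (circ f) dvd p \<longleftrightarrow> f [^]\<^bsub>F2G\<^esub> p = \<one>\<^bsub>F2G\<^esub>"
proof -
  let ?M = "ring_mat TYPE(bit) p ()"
  interpret M: ring ?M by (rule ring_mat)
  interpret U: group "units_of ?M" by (rule M.units_group)
  obtain h where h: "h \<in> carrier F2G" "f \<otimes>\<^bsub>F2G\<^esub> h = \<one>\<^bsub>F2G\<^esub>" "h \<otimes>\<^bsub>F2G\<^esub> f = \<one>\<^bsub>F2G\<^esub>"
    using f(2) unfolding Units_def by blast
  have "circ f * circ h = 1\<^sub>m p" "circ h * circ f = 1\<^sub>m p"
    using h f by (simp_all add: circ_mult[symmetric] circ_one)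
  then have U: "circ f \<in> Units ?M"
    unfolding Units_def by (auto simp: ring_mat_simps intro!: bexI[of _ "circ h"])
  have pow: "circ f [^]\<^bsub>?M\<^esub> n = circ (f [^]\<^bsub>F2G\<^esub> n)" for n :: nat
    by (induction n) (simp_all add: ring_mat_simps circ_one circ_mult f)
  have "matrix_order p (circ f) dvd p \<longleftrightarrow> circ f [^]\<^bsub>units_of ?M\<^esub> p = \<one>\<^bsub>units_of ?M\<^esub>"
    unfolding matrix_order_def using U.pow_eq_id[of "circ f" p] U by (simp add: units_of_carrier)
  also have "\<dots> \<longleftrightarrow> circ (f [^]\<^bsub>F2G\<^esub> p) = circ \<one>\<^bsub>F2G\<^esub>"
    using U by (simp add: M.units_of_pow units_of_one pow circ_one ring_mat_simps)
  also have "\<dots> \<longleftrightarrow> f [^]\<^bsub>F2G\<^esub> p = \<one>\<^bsub>F2G\<^esub>" using f by (simp add: circ_eq_iff)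
  finally show ?thesis .
qed

lemma permutation_circ_iff:
  assumes f: "f \<in> carrier F2G"
  shows "permutation_matrix p (circ f) \<longleftrightarrow> f \<in> group_elt ` carrier G"
proof
  assume "permutation_matrix p (circ f)"
  then obtain \<sigma> where \<sigma>: "\<sigma> permutes {..<p}"
    and eq: "circ f = mat p p (\<lambda>(i, j). if i = \<sigma> j then 1 else 0)"
    unfolding permutation_matrix_def by blast
  have \<sigma>0: "\<sigma> 0 < p" using permutes_in_image[OF \<sigma>, of 0] p_gt_2 by simp
  have "f = group_elt (g [^] \<sigma> 0)"
  proof (rule KG_eqI[OF f])
    fix x assume "x \<in> carrier G"
    then obtain i where i: "i < p" "x = g [^] i" by (rule obtain_pow_g)
    have "f x = circ f $$ (i, 0)" using i p_gt_2 by (simp add: circ_index)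
    also have "\<dots> = (if i = \<sigma> 0 then 1 else 0)" using i p_gt_2 by (simp add: eq)
    also have "\<dots> = group_elt (g [^] \<sigma> 0) x"
      using i \<sigma>0 by (simp add: group_elt_def pow_g_eq_iff cong_def)
    finally show "f x = group_elt (g [^] \<sigma> 0) x" .
  qed simp
  then show "f \<in> group_elt ` carrier G" by simp
next
  assume "f \<in> group_elt ` carrier G"
  then obtain k where k: "k < p" "f = group_elt (g [^] k)" using obtain_pow_g by blast
  \<comment> \<open>Multiplication by \<open>g [^] k\<close> in coordinates; permutations must fix everything outside their set.\<close>
  define \<sigma> where "\<sigma> j = (if j < p then (j + k) mod p else j)" for j
  have "\<sigma> permutes {..<p}"
  proof (rule bij_imp_permutes)
    have "inj_on \<sigma> {..<p}"
    proof (rule inj_onI)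
      fix a b assume "a \<in> {..<p}" "b \<in> {..<p}" "\<sigma> a = \<sigma> b"
      then have "[a + k = b + k] (mod p)" and "a < p" "b < p" by (simp_all add: \<sigma>_def cong_def)
      then show "a = b" by (simp add: cong_add_rcancel_nat cong_less_modulus_unique_nat)
    qed
    moreover have "\<sigma> ` {..<p} \<subseteq> {..<p}" using p_gt_2 by (auto simp: \<sigma>_def)
    ultimately show "bij_betw \<sigma> {..<p} {..<p}"
      unfolding bij_betw_def by (simp add: endo_inj_surj)
  qed (simp add: \<sigma>_def)
  moreover have "circ f = mat p p (\<lambda>(i, j). if i = \<sigma> j then 1 else 0)"
  proof (rule eq_matI)
    fix i j assume "i < dim_row (mat p p (\<lambda>(i, j). if i = \<sigma> j then 1 else 0 :: bit))"
      "j < dim_col (mat p p (\<lambda>(i, j). if i = \<sigma> j then 1 else 0 :: bit))"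
    then have i: "i < p" and j: "j < p" by simp_all
    have "g [^] i \<otimes> inv (g [^] j) = g [^] k \<longleftrightarrow> g [^] i = g [^] (j + k)"
      by (simp add: inv_solve_right' m_comm nat_pow_mult add.commute)
    also have "\<dots> \<longleftrightarrow> i = \<sigma> j" using i j by (simp add: pow_g_eq_iff cong_def \<sigma>_def)
    finally show "circ f $$ (i, j) = mat p p (\<lambda>(i, j). if i = \<sigma> j then 1 else 0) $$ (i, j)"
      using i j by (simp add: circ_index k(2) group_elt_def)
  qed (simp_all add: circ_def)
  ultimately show "permutation_matrix p (circ f)" unfolding permutation_matrix_def by blast
qed

end

section \<open>Perfect matchings and pseudopaths as matrix invariants\<close>

text \<open>
  The biadjacency matrix with entries in a type of choice, so that one graph can be read modulo 2.
\<close>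

definition edge_mat :: "nat \<Rightarrow> bigraph \<Rightarrow> 'a::zero_neq_one mat" where
  "edge_mat n E = mat n n (\<lambda>(i, j). if (i, j) \<in> E then 1 else 0)"

lemma circulant_biadjacency_iff: "circulant n (biadjacency n E) \<longleftrightarrow> circulant n (edge_mat n E :: bit mat)"
  unfolding biadjacency_def edge_mat_def circulant_mat_iff by simp

text \<open>
  Perfect matchings are the permutations whose graph lies in the edge set, as in the expansion
  of a permanent.
\<close>

lemma bij_betw_perfect_matchings:
  assumes E: "E \<subseteq> {..<n} \<times> {..<n}"
  shows "bij_betw (\<lambda>\<sigma>. (\<lambda>i. (i, \<sigma> i)) ` {..<n})
    {\<sigma>. \<sigma> permutes {0..<n} \<and> (\<forall>i<n. (i, \<sigma> i) \<in> E)} (perfect_matchings n E)"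
  unfolding bij_betw_def
proof
  let ?P = "{\<sigma>. \<sigma> permutes {0..<n} \<and> (\<forall>i<n. (i, \<sigma> i) \<in> E)}"
  let ?M = "\<lambda>\<sigma>. (\<lambda>i. (i, \<sigma> i)) ` {..<n}"
  show "inj_on ?M ?P"
  proof (rule inj_onI)
    fix \<sigma> \<tau> assume \<sigma>: "\<sigma> \<in> ?P" and \<tau>: "\<tau> \<in> ?P" and eq: "?M \<sigma> = ?M \<tau>"
    show "\<sigma> = \<tau>"
    proof
      fix i show "\<sigma> i = \<tau> i"
      proof (cases "i < n")
        case True
        then have "(i, \<sigma> i) \<in> ?M \<tau>" unfolding eq[symmetric] by blast
        then show ?thesis by auto
      next
        case False
        then have "i \<notin> {0..<n}" by simp
          then show ?thesis using \<sigma> \<tau> permutes_not_in by (metis (mono_tags, lifting) mem_Collect_eq)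
      qed
    qed
  qed
  show "?M ` ?P = perfect_matchings n E"
  proof (intro equalityI subsetI)
    fix M assume "M \<in> ?M ` ?P"
    then obtain \<sigma> where \<sigma>: "\<sigma> permutes {0..<n}" "\<forall>i<n. (i, \<sigma> i) \<in> E" and M: "M = ?M \<sigma>"
      by (elim imageE CollectE conjE)
    have "\<exists>!e. e \<in> M \<and> fst e = i" if "i < n" for i
      using that unfolding M by (intro ex1I[of _ "(i, \<sigma> i)"]) auto
    moreover have "\<exists>!e. e \<in> M \<and> snd e = j" if "j < n" for j
    proof -
      have "j \<in> \<sigma> ` {0..<n}" using permutes_image[OF \<sigma>(1)] that by simp
      then obtain i where i: "i < n" "j = \<sigma> i" by auto
      show ?thesis
      proof (rule ex1I[of _ "(i, j)"])
        show "(i, j) \<in> M \<and> snd (i, j) = j" using i unfolding M by simp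
      next
        fix e assume e: "e \<in> M \<and> snd e = j"
        then obtain a where a: "e = (a, \<sigma> a)" unfolding M by blast
        with e i have "\<sigma> a = \<sigma> i" by simp
        then have "a = i" by (rule injD[OF permutes_inj[OF \<sigma>(1)]])
        then show "e = (i, j)" using a i by simp
      qed
    qed
    ultimately show "M \<in> perfect_matchings n E"
      using \<sigma>(2) unfolding perfect_matchings_def M by blast
  next
    fix M assume "M \<in> perfect_matchings n E"
    note * = this[unfolded perfect_matchings_def mem_Collect_eq]
    note ME = *[THEN conjunct1]
      and row = *[THEN conjunct2, THEN conjunct1, rule_format]
      and col = *[THEN conjunct2, THEN conjunct2, rule_format]
    define \<sigma> where "\<sigma> i = (if i < n then snd (THE e. e \<in> M \<and> fst e = i) else i)" for i
    have \<sigma>M: "(i, \<sigma> i) \<in> M" if i: "i < n" for i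
    proof -
      obtain e where e: "e \<in> M" "fst e = i" using row[OF i] by blast
      have "(THE e. e \<in> M \<and> fst e = i) = e" by (rule the1_equality[OF row[OF i]]) (simp add: e)
      then have "(i, \<sigma> i) = e" using e i by (simp add: \<sigma>_def prod_eq_iff)
      then show ?thesis using e by simp
    qed
    have M\<sigma>: "a < n" "b = \<sigma> a" if "(a, b) \<in> M" for a b
    proof -
      show a: "a < n" using that ME E by blast
      obtain e where "\<And>y. y \<in> M \<Longrightarrow> fst y = a \<Longrightarrow> y = e" using row[OF a] by blast
      from this[OF that] this[OF \<sigma>M[OF a]] have "(a, b) = (a, \<sigma> a)" by simp
      then show "b = \<sigma> a" by simp
    qed
    have \<sigma>n: "\<sigma> i < n" if "i < n" for i using \<sigma>M[OF that] ME E by auto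
    have "inj_on \<sigma> {0..<n}"
    proof (rule inj_onI)
      fix a b assume "a \<in> {0..<n}" "b \<in> {0..<n}" and eq: "\<sigma> a = \<sigma> b"
      then have ab: "a < n" "b < n" by simp_all
      obtain e where "\<And>y. y \<in> M \<Longrightarrow> snd y = \<sigma> a \<Longrightarrow> y = e" using col[OF \<sigma>n[OF ab(1)]] by blast
      from this[OF \<sigma>M[OF ab(1)]] this[OF \<sigma>M[OF ab(2)]] eq have "(a, \<sigma> a) = (b, \<sigma> b)" by simp
      then show "a = b" by simp
    qed
    moreover have "\<sigma> ` {0..<n} \<subseteq> {0..<n}" using \<sigma>n by auto
    ultimately have "bij_betw \<sigma> {0..<n} {0..<n}" unfolding bij_betw_def by (simp add: endo_inj_surj)
    then have "\<sigma> permutes {0..<n}" by (rule bij_imp_permutes) (simp add: \<sigma>_def)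
    moreover have "M = ?M \<sigma>"
    proof (intro equalityI subsetI)
      fix e assume "e \<in> M"
      moreover obtain a b where "e = (a, b)" by (rule prod.exhaust)
      ultimately show "e \<in> ?M \<sigma>" using M\<sigma>[of a b] by simp
    next
      fix e assume "e \<in> ?M \<sigma>"
      then show "e \<in> M" using \<sigma>M by auto
    qed
    moreover have "\<forall>i<n. (i, \<sigma> i) \<in> E" using \<sigma>M ME by blast
    ultimately show "M \<in> ?M ` ?P" by blast
  qed
qed

text \<open>
  Modulo 2 all signs are 1, so the determinant agrees with the permanent, which counts perfect matchings.
\<close>

lemma det_edge_mat_bit:
  assumes E: "E \<subseteq> {..<n} \<times> {..<n}"
  shows "det (edge_mat n E :: bit mat) = of_nat (card (perfect_matchings n E))"
proof -
  let ?P = "{\<sigma>. \<sigma> permutes {0..<n}}"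
  have sign: "signof \<sigma> = (1 :: bit)" for \<sigma> :: "nat \<Rightarrow> nat"
    by (simp add: sign_def)
  have prod: "(\<Prod>i = 0..<n. edge_mat n E $$ (i, \<sigma> i)) = (if \<forall>i<n. (i, \<sigma> i) \<in> E then 1 else 0 :: bit)"
    if "\<sigma> permutes {0..<n}" for \<sigma>
  proof -
    have *: "edge_mat n E $$ (i, \<sigma> i) = (if (i, \<sigma> i) \<in> E then 1 else 0 :: bit)" if "i \<in> {0..<n}" for i
      using that permutes_in_image[OF \<open>\<sigma> permutes {0..<n}\<close>, of i] by (simp add: edge_mat_def)
    show ?thesis
    proof (cases "\<forall>i<n. (i, \<sigma> i) \<in> E")
      case True
      then show ?thesis by (simp add: *)
    next
      case False
      then obtain i where "i < n" "(i, \<sigma> i) \<notin> E" by blast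
      then have "\<exists>i\<in>{0..<n}. edge_mat n E $$ (i, \<sigma> i) = (0 :: bit)"
        by (intro bexI[of _ i]) (simp_all add: *)
      then have "(\<Prod>i = 0..<n. edge_mat n E $$ (i, \<sigma> i)) = (0 :: bit)"
        by (intro prod_zero) auto
      then show ?thesis by (simp only: if_not_P[OF False])
    qed
  qed
  have "det (edge_mat n E :: bit mat) = (\<Sum>\<sigma>\<in>?P. signof \<sigma> * (\<Prod>i = 0..<n. edge_mat n E $$ (i, \<sigma> i)))"
    by (rule det_def') (simp add: edge_mat_def)
  also have "\<dots> = (\<Sum>\<sigma>\<in>?P. if \<forall>i<n. (i, \<sigma> i) \<in> E then 1 else 0)"
    by (intro sum.cong refl) (simp only: mem_Collect_eq sign prod mult_1_left)
  also have "\<dots> = (\<Sum>\<sigma>\<in>{\<sigma>. \<sigma> permutes {0..<n} \<and> (\<forall>i<n. (i, \<sigma> i) \<in> E)}. 1)"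
    by (rule sum.mono_neutral_cong_right) (auto simp: finite_permutations)
  also have "\<dots> = of_nat (card (perfect_matchings n E))"
    by (simp add: bij_betw_same_card[OF bij_betw_perfect_matchings[OF E]])
  finally show ?thesis .
qed

lemma invertible_mat_iff_det:
  fixes A :: "'a::field mat"
  assumes A: "A \<in> carrier_mat n n"
  shows "invertible_mat A \<longleftrightarrow> det A \<noteq> 0"
proof
  assume "invertible_mat A"
  then obtain B where "inverts_mat A B" "inverts_mat B A" unfolding invertible_mat_def by blast
  then have AB: "A * B = 1\<^sub>m n" and BA: "B * A = 1\<^sub>m (dim_row B)"
    using A unfolding inverts_mat_def by simp_all
  have "dim_row B = n" using arg_cong[OF BA, of dim_col] A by simp
  moreover have "dim_col B = n" using arg_cong[OF AB, of dim_col] by simp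
  ultimately have "B \<in> carrier_mat n n" by blast
  then have "det A * det B = 1" using det_mult[OF A, of B] by (simp add: AB)
  then show "det A \<noteq> 0" by auto
next
  assume "det A \<noteq> 0"
  then have "A \<in> Units (ring_mat TYPE('a) n ())" by (rule det_non_zero_imp_unit[OF A])
  then obtain B where B: "B \<in> carrier_mat n n" "A * B = 1\<^sub>m n" "B * A = 1\<^sub>m n"
    unfolding Units_def ring_mat_simps by blast
  then have "inverts_mat A B" "inverts_mat B A" using A unfolding inverts_mat_def by simp_all
  moreover have "square_mat A" using A by simp
  ultimately show "invertible_mat A" unfolding invertible_mat_def by blast
qed

lemma of_nat_bit_eq_0_iff: "(of_nat m :: bit) = 0 \<longleftrightarrow> even m"
  by (metis bit_not_zero_iff even_of_nat_iff even_zero odd_one)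

lemma odd_perfect_matchings_iff:
  assumes "E \<subseteq> {..<n} \<times> {..<n}"
  shows "odd (card (perfect_matchings n E)) \<longleftrightarrow> invertible_mat (edge_mat n E :: bit mat)"
proof -
  have "invertible_mat (edge_mat n E :: bit mat) \<longleftrightarrow> (of_nat (card (perfect_matchings n E)) :: bit) \<noteq> 0"
    by (subst invertible_mat_iff_det[of _ n]) (simp_all only: det_edge_mat_bit assms, simp add: edge_mat_def)
  also have "\<dots> \<longleftrightarrow> odd (card (perfect_matchings n E))"
    by (simp only: of_nat_bit_eq_0_iff)
  finally show ?thesis ..
qed

lemma finite_pseudopaths:
  assumes "finite E"
  shows "finite (pseudopaths E r i j)"
  by (rule finite_subset[OF _ finite_lists_length_eq[OF assms, of r]]) (auto simp: pseudopaths_def)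

text \<open>
  Splitting off the last edge matches the recursion of matrix powers, which multiplies on the right.
  Pseudopaths are nonempty by definition, so the recursion starts at length 1.
\<close>

lemma pseudopaths_Suc:
  assumes E: "E \<subseteq> {..<n} \<times> {..<n}"
  shows "pseudopaths E (Suc (Suc r)) i j =
    (\<Union>k\<in>{k \<in> {..<n}. (k, j) \<in> E}. (\<lambda>es. es @ [(k, j)]) ` pseudopaths E (Suc r) i k)"
    (is "?L = ?R")
proof (intro equalityI subsetI)
  fix es assume es: "es \<in> ?L"
  then have len: "length es = Suc (Suc r)" and set: "set es \<subseteq> E"
    and link: "\<And>k. Suc k < Suc (Suc r) \<Longrightarrow> snd (es ! k) = fst (es ! Suc k)"
    and ends: "fst (hd es) = i" "snd (last es) = j"
    unfolding pseudopaths_def by auto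
  obtain es' e where es': "es = es' @ [e]" using len by (metis length_0_conv nat.distinct(1) rev_exhaust)
  define k where "k = fst e"
  have e: "e = (k, j)" using ends es' by (simp add: k_def prod_eq_iff)
  have len': "length es' = Suc r" using len es' by simp
  then have ne: "es' \<noteq> []" by auto
  have "snd (last es') = k"
    using link[of r] len' ne unfolding es' k_def by (simp add: nth_append last_conv_nth)
  moreover have "snd (es' ! m) = fst (es' ! Suc m)" if "Suc m < Suc r" for m
    using link[of m] that len' unfolding es' by (simp add: nth_append)
  ultimately have "es' \<in> pseudopaths E (Suc r) i k"
    using len' ne set ends unfolding pseudopaths_def es' by auto
  moreover have "(k, j) \<in> E" using set unfolding es' e by simp
  moreover have "k < n" using \<open>(k, j) \<in> E\<close> E by auto
  ultimately show "es \<in> ?R" unfolding es' e by blast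
next
  fix es assume "es \<in> ?R"
  then obtain k es' where kE: "(k, j) \<in> E" and es': "es' \<in> pseudopaths E (Suc r) i k" and es: "es = es' @ [(k, j)]"
    by blast
  have len': "length es' = Suc r" and ne: "es' \<noteq> []" and last: "snd (last es') = k"
    and link: "\<And>m. Suc m < Suc r \<Longrightarrow> snd (es' ! m) = fst (es' ! Suc m)"
    using es' unfolding pseudopaths_def by auto
  have "snd (es ! m) = fst (es ! Suc m)" if "Suc m < Suc (Suc r)" for m
  proof (cases "Suc m < Suc r")
    case True
    then show ?thesis using link[OF True] len' unfolding es by (simp add: nth_append)
  next
    case False
    then have "m = r" using that by simp
    then show ?thesis using last len' ne unfolding es by (simp add: nth_append last_conv_nth)
  qed
  then show "es \<in> ?L"
    using es' kE ne len' unfolding pseudopaths_def es by auto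
qed

lemma of_nat_pseudopath_count:
  assumes E: "E \<subseteq> {..<n} \<times> {..<n}" and i: "i < n" and j: "j < n"
  shows "of_nat (pseudopath_count E (Suc r) i j) = ((edge_mat n E ^\<^sub>m Suc r) $$ (i, j) :: 'a::comm_ring_1)"
  using j
proof (induction r arbitrary: j)
  case 0
  have "pseudopaths E (Suc 0) i j = (if (i, j) \<in> E then {[(i, j)]} else {})"
    unfolding pseudopaths_def by (auto simp: length_Suc_conv)
  then show ?case using i 0 by (simp add: pseudopath_count_def edge_mat_def)
next
  case (Suc r)
  have fin: "finite E" using E by (rule finite_subset) simp
  let ?K = "{k \<in> {..<n}. (k, j) \<in> E}"
  let ?A = "edge_mat n E :: 'a mat"
  have Ac: "?A \<in> carrier_mat n n" by (simp add: edge_mat_def)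
  have "pseudopath_count E (Suc (Suc r)) i j =
      (\<Sum>k\<in>?K. card ((\<lambda>es. es @ [(k, j)]) ` pseudopaths E (Suc r) i k))"
    unfolding pseudopath_count_def pseudopaths_Suc[OF E]
    by (rule card_UN_disjoint) (auto simp: finite_pseudopaths[OF fin])
  also have "\<dots> = (\<Sum>k\<in>?K. pseudopath_count E (Suc r) i k)"
    by (intro sum.cong refl) (simp add: pseudopath_count_def card_image inj_on_def)
  finally have "(of_nat (pseudopath_count E (Suc (Suc r)) i j) :: 'a) =
      (\<Sum>k\<in>?K. (?A ^\<^sub>m Suc r) $$ (i, k))"
    using Suc.IH by simp
  also have "\<dots> = (\<Sum>k\<in>{0..<n}. (?A ^\<^sub>m Suc r) $$ (i, k) * ?A $$ (k, j))"
    by (rule sum.mono_neutral_cong_left) (use Suc.prems in \<open>auto simp: edge_mat_def\<close>)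
  also have "\<dots> = (?A ^\<^sub>m Suc r * ?A) $$ (i, j)"
    using i Suc.prems Ac pow_carrier_mat[OF Ac, of "Suc r"]
    by (simp add: scalar_prod_def del: pow_mat.simps)
  finally show ?case by simp
qed

section \<open>Circulant bipartite graphs\<close>

context odd_prime_group begin

definition circ_graph :: "('a \<Rightarrow> bit) \<Rightarrow> bigraph" where
  "circ_graph f = {(i, j). i < p \<and> j < p \<and> f (g [^] i \<otimes> inv (g [^] j)) \<noteq> 0}"

lemma circ_graph_subset: "circ_graph f \<subseteq> {..<p} \<times> {..<p}"
  by (auto simp: circ_graph_def)

lemma edge_mat_circ_graph: "edge_mat p (circ_graph f) = circ f"
  by (rule eq_matI) (auto simp: edge_mat_def circ_def circ_graph_def)

lemma bij_betw_circ_graph: "bij_betw circ_graph (carrier F2G) {E. circulant_graph p E}"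
  unfolding bij_betw_def
proof
  show "inj_on circ_graph (carrier F2G)"
    by (rule inj_onI) (metis edge_mat_circ_graph circ_eq_iff)
  show "circ_graph ` carrier F2G = {E. circulant_graph p E}"
  proof (intro equalityI subsetI)
    fix E assume "E \<in> circ_graph ` carrier F2G"
    then show "E \<in> {E. circulant_graph p E}"
      using circ_graph_subset
      by (auto simp: circulant_graph_def bipartite_graph_def circulant_biadjacency_iff
          edge_mat_circ_graph circulant_circ)
  next
    fix E assume "E \<in> {E. circulant_graph p E}"
    then have E: "E \<subseteq> {..<p} \<times> {..<p}" and "circulant p (edge_mat p E :: bit mat)"
      by (simp_all add: circulant_graph_def bipartite_graph_def circulant_biadjacency_iff)
    then obtain f where f: "f \<in> carrier F2G" "edge_mat p E = circ f"
      using bij_betw_circ unfolding bij_betw_def by blast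
    have "(i, j) \<in> E \<longleftrightarrow> (i, j) \<in> circ_graph f" for i j
    proof (cases "i < p \<and> j < p")
      case True
      then have "(i, j) \<in> E \<longleftrightarrow> (edge_mat p E :: bit mat) $$ (i, j) \<noteq> 0" by (simp add: edge_mat_def)
      then show ?thesis using True by (simp add: f circ_index circ_graph_def)
    next
      case False
      then show ?thesis using E circ_graph_subset[of f] by blast
    qed
    then have "E = circ_graph f" by auto
    then show "E \<in> circ_graph ` carrier F2G" using f by blast
  qed
qed

lemma odd_perfect_matchings_circ_graph_iff:
  "f \<in> carrier F2G \<Longrightarrow> odd (card (perfect_matchings p (circ_graph f))) \<longleftrightarrow> f \<in> Units F2G"
  unfolding odd_perfect_matchings_iff[OF circ_graph_subset] edge_mat_circ_graph
  by (rule invertible_circ_iff)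

lemma pseudopath_count_circ_graph_iff:
  assumes f: "f \<in> carrier F2G"
  shows "(\<forall>i<p. \<forall>j<p. pseudopath_count (circ_graph f) p i j mod 2 = (if i = j then 1 else 0)) \<longleftrightarrow>
    f [^]\<^bsub>F2G\<^esub> p = \<one>\<^bsub>F2G\<^esub>"
proof -
  obtain r where r: "p = Suc r" using p_gt_2 by (cases p) auto
  have bit: "m mod 2 = (if P then 1 else 0) \<longleftrightarrow> (of_nat m :: bit) = (if P then 1 else 0)" for m :: nat and P
    using of_nat_bit_eq_0_iff[of m] by (cases "even m") (auto simp: odd_iff_mod_2_eq_one)
  have count: "(of_nat (pseudopath_count (circ_graph f) p i j) :: bit) = (circ f ^\<^sub>m p) $$ (i, j)"
    if "i < p" "j < p" for i j
    using of_nat_pseudopath_count[OF circ_graph_subset that, where 'a = bit, of f r]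
    unfolding r[symmetric] edge_mat_circ_graph .
  have "(\<forall>i<p. \<forall>j<p. pseudopath_count (circ_graph f) p i j mod 2 = (if i = j then 1 else 0)) \<longleftrightarrow>
      (\<forall>i<p. \<forall>j<p. (circ f ^\<^sub>m p) $$ (i, j) = (if i = j then 1 else 0))"
    unfolding bit by (simp only: count cong: imp_cong)
  also have "\<dots> \<longleftrightarrow> circ f ^\<^sub>m p = 1\<^sub>m p"
    by (auto simp: mat_eq_iff circ_pow[OF f])
  also have "\<dots> \<longleftrightarrow> circ (f [^]\<^bsub>F2G\<^esub> p) = circ \<one>\<^bsub>F2G\<^esub>"
    by (simp only: circ_pow[OF f] circ_one)
  also have "\<dots> \<longleftrightarrow> f [^]\<^bsub>F2G\<^esub> p = \<one>\<^bsub>F2G\<^esub>" using f by (simp add: circ_eq_iff)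
  finally show ?thesis .
qed

lemma card_preimage_support:
  assumes f: "f \<in> carrier F2G" and \<phi>: "bij_betw \<phi> {..<p} (carrier G)"
  shows "card {j. j < p \<and> f (\<phi> j) \<noteq> 0} = card {x. f x \<noteq> 0}"
proof (rule bij_betw_same_card)
  show "bij_betw \<phi> {j. j < p \<and> f (\<phi> j) \<noteq> 0} {x. f x \<noteq> 0}"
    unfolding bij_betw_def
  proof
    show "inj_on \<phi> {j. j < p \<and> f (\<phi> j) \<noteq> 0}"
      using \<phi> unfolding bij_betw_def by (auto intro: inj_on_subset)
    show "\<phi> ` {j. j < p \<and> f (\<phi> j) \<noteq> 0} = {x. f x \<noteq> 0}"
    proof (intro equalityI subsetI)
      fix x assume x: "x \<in> {x. f x \<noteq> 0}"
      then have "x \<in> carrier G" using outside[OF f] by blast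
      then have "x \<in> \<phi> ` {..<p}" using \<phi> unfolding bij_betw_def by blast
      then show "x \<in> \<phi> ` {j. j < p \<and> f (\<phi> j) \<noteq> 0}" using x by blast
    qed blast
  qed
qed

lemma regular_circ_graph_iff:
  assumes f: "f \<in> carrier F2G"
  shows "regular_of_degree p (circ_graph f) d \<longleftrightarrow> card {x. f x \<noteq> 0} = d"
proof -
  have row: "card {e \<in> circ_graph f. fst e = i} = card {x. f x \<noteq> 0}" if i: "i < p" for i
  proof -
    have "{e \<in> circ_graph f. fst e = i} = Pair i ` {j. j < p \<and> f (g [^] i \<otimes> inv (g [^] j)) \<noteq> 0}"
      using i by (auto simp: circ_graph_def)
    moreover have "bij_betw (\<lambda>x. g [^] i \<otimes> inv x) (carrier G) (carrier G)"
      by (rule bij_betw_byWitness[where f' = "\<lambda>x. g [^] i \<otimes> inv x"])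
        (auto simp: inv_mult_group m_assoc[symmetric] m_comm[of _ "inv (g [^] i)"])
    note bij_betw_trans[OF bij_betw_pow_g this]
    ultimately show ?thesis
      using card_preimage_support[OF f] by (simp add: card_image inj_on_def comp_def)
  qed
  have col: "card {e \<in> circ_graph f. snd e = j} = card {x. f x \<noteq> 0}" if j: "j < p" for j
  proof -
    have "{e \<in> circ_graph f. snd e = j} = (\<lambda>i. (i, j)) ` {i. i < p \<and> f (g [^] i \<otimes> inv (g [^] j)) \<noteq> 0}"
      using j by (auto simp: circ_graph_def)
    moreover have "bij_betw (\<lambda>x. x \<otimes> inv (g [^] j)) (carrier G) (carrier G)"
      by (rule bij_betw_byWitness[where f' = "\<lambda>x. x \<otimes> g [^] j"]) (auto simp: m_assoc)
    note bij_betw_trans[OF bij_betw_pow_g this]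
    ultimately show ?thesis
      using card_preimage_support[OF f] by (simp add: card_image inj_on_def comp_def)
  qed
  have "0 < p" using p_gt_2 by simp
  then show ?thesis unfolding regular_of_degree_def using row col by auto
qed

lemma group_elt_iff_card_support:
  assumes f: "f \<in> carrier F2G"
  shows "f \<in> group_elt ` carrier G \<longleftrightarrow> card {x. f x \<noteq> 0} = 1"
proof
  assume "card {x. f x \<noteq> 0} = 1"
  then obtain x where x: "{x. f x \<noteq> 0} = {x}" by (rule card_1_singletonE)
  then have "x \<in> carrier G" using outside[OF f] by blast
  moreover have "f = group_elt x"
  proof
    fix y
    have "f y \<noteq> 0 \<longleftrightarrow> y = x" using x by blast
    then show "f y = group_elt x y" by (cases "y = x") (simp_all add: group_elt_def)
  qed
  ultimately show "f \<in> group_elt ` carrier G" by blast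
next
  assume "f \<in> group_elt ` carrier G"
  then obtain x where "f = group_elt x" by blast
  then have "{x. f x \<noteq> 0} = {x}" by (simp add: group_elt_def)
  then show "card {x. f x \<noteq> 0} = 1" by simp
qed

lemma circ_graph_norm: "circ_graph \<nu> = complete_bigraph p"
  by (auto simp: circ_graph_def complete_bigraph_def norm_element_apply)

lemma circulant_obtain:
  fixes A :: "bit mat"
  assumes "circulant p A"
  obtains f where "f \<in> carrier F2G" "A = circ f"
  using assms bij_betw_circ unfolding bij_betw_def by blast

lemma circulant_graph_obtain:
  assumes "circulant_graph p E"
  obtains f where "f \<in> carrier F2G" "E = circ_graph f"
  using assms bij_betw_circ_graph unfolding bij_betw_def by blast

lemma circulant_circ_graph: "f \<in> carrier F2G \<Longrightarrow> circulant_graph p (circ_graph f)"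
  using bij_betw_circ_graph unfolding bij_betw_def by blast

lemma circ_graph_eq_iff: "f \<in> carrier F2G \<Longrightarrow> h \<in> carrier F2G \<Longrightarrow> circ_graph f = circ_graph h \<longleftrightarrow> f = h"
  using bij_betw_circ_graph unfolding bij_betw_def inj_on_def by blast

section \<open>The conditions on matrices and graphs\<close>

theorem primitive_root_iff_card_circulant:
  "primitive_root_mod p 2 \<longleftrightarrow> card {A :: bit mat. circulant p A \<and> invertible_mat A} = 2 ^ (p - 1) - 1"
proof -
  have "{A :: bit mat. circulant p A \<and> invertible_mat A} = circ ` Units F2G"
  proof (intro equalityI subsetI)
    fix A :: "bit mat" assume "A \<in> {A. circulant p A \<and> invertible_mat A}"
    then have "circulant p A" and inv: "invertible_mat A" by simp_all
    then obtain f where "f \<in> carrier F2G" "A = circ f" by (elim circulant_obtain)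
    with inv show "A \<in> circ ` Units F2G" by (simp add: invertible_circ_iff)
  next
    fix A :: "bit mat" assume "A \<in> circ ` Units F2G"
    then obtain f where "f \<in> Units F2G" "A = circ f" by blast
    then show "A \<in> {A. circulant p A \<and> invertible_mat A}"
      by (simp add: circulant_circ invertible_circ_iff R.Units_closed)
  qed
  moreover have "inj_on circ (Units F2G)"
    by (rule inj_onI) (simp add: circ_eq_iff R.Units_closed)
  ultimately show ?thesis unfolding primitive_root_iff_card_Units by (simp only: card_image)
qed

theorem primitive_root_iff_card_circulant_graphs:
  "primitive_root_mod p 2 \<longleftrightarrow>
    card {E. circulant_graph p E \<and> odd (card (perfect_matchings p E))} = 2 ^ (p - 1) - 1"
proof -
  have "{E. circulant_graph p E \<and> odd (card (perfect_matchings p E))} = circ_graph ` Units F2G"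
  proof (intro equalityI subsetI)
    fix E assume "E \<in> {E. circulant_graph p E \<and> odd (card (perfect_matchings p E))}"
    then have "circulant_graph p E" and odd: "odd (card (perfect_matchings p E))" by simp_all
    then obtain f where "f \<in> carrier F2G" "E = circ_graph f" by (elim circulant_graph_obtain)
    with odd show "E \<in> circ_graph ` Units F2G" by (simp only: odd_perfect_matchings_circ_graph_iff imageI)
  next
    fix E assume "E \<in> circ_graph ` Units F2G"
    then obtain f where "f \<in> Units F2G" "E = circ_graph f" by blast
    then show "E \<in> {E. circulant_graph p E \<and> odd (card (perfect_matchings p E))}"
      by (simp only: mem_Collect_eq circulant_circ_graph odd_perfect_matchings_circ_graph_iff R.Units_closed simp_thms)
  qed
  moreover have "inj_on circ_graph (Units F2G)"
    by (rule inj_onI) (simp add: circ_graph_eq_iff R.Units_closed)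
  ultimately show ?thesis unfolding primitive_root_iff_card_Units by (simp only: card_image)
qed

theorem primitive_root_iff_circulant_roots_of_unity:
  "primitive_root_mod p 2 \<longleftrightarrow>
    {A :: bit mat. circulant p A \<and> invertible_mat A \<and> matrix_order p A dvd p}
      = {A. circulant p A \<and> permutation_matrix p A}"
proof -
  let ?T = "{u \<in> carrier F2G. u [^]\<^bsub>F2G\<^esub> p = \<one>\<^bsub>F2G\<^esub>}"
  have "{A :: bit mat. circulant p A \<and> invertible_mat A \<and> matrix_order p A dvd p} = circ ` ?T"
  proof (intro equalityI subsetI)
    fix A :: "bit mat" assume "A \<in> {A. circulant p A \<and> invertible_mat A \<and> matrix_order p A dvd p}"
    then have "circulant p A" and A: "invertible_mat A" "matrix_order p A dvd p" by simp_all
    then obtain f where f: "f \<in> carrier F2G" "A = circ f" by (elim circulant_obtain)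
    then have "f \<in> Units F2G" using A(1) by (simp add: invertible_circ_iff)
    then have "f \<in> ?T" using A(2) f by (simp add: matrix_order_circ_dvd_iff)
    then show "A \<in> circ ` ?T" using f(2) by blast
  next
    fix A :: "bit mat" assume "A \<in> circ ` ?T"
    then obtain f where f: "f \<in> carrier F2G" "f [^]\<^bsub>F2G\<^esub> p = \<one>\<^bsub>F2G\<^esub>" "A = circ f" by blast
    then have "f \<in> Units F2G" by (intro pth_root_of_unity_Units)
    then show "A \<in> {A. circulant p A \<and> invertible_mat A \<and> matrix_order p A dvd p}"
      using f by (simp add: circulant_circ invertible_circ_iff matrix_order_circ_dvd_iff)
  qed
  moreover have "{A :: bit mat. circulant p A \<and> permutation_matrix p A} = circ ` group_elt ` carrier G"
  proof (intro equalityI subsetI)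
    fix A :: "bit mat" assume "A \<in> {A. circulant p A \<and> permutation_matrix p A}"
    then have "circulant p A" and A: "permutation_matrix p A" by simp_all
    then obtain f where f: "f \<in> carrier F2G" "A = circ f" by (elim circulant_obtain)
    then show "A \<in> circ ` group_elt ` carrier G" using A permutation_circ_iff by blast
  next
    fix A :: "bit mat" assume "A \<in> circ ` group_elt ` carrier G"
    then obtain x where x: "x \<in> carrier G" "A = circ (group_elt x :: 'a \<Rightarrow> bit)" by blast
    then show "A \<in> {A. circulant p A \<and> permutation_matrix p A}"
      using permutation_circ_iff[OF group_elt_closed[OF x(1)]] by (simp add: circulant_circ)
  qed
  moreover have "circ ` ?T = circ ` group_elt ` carrier G \<longleftrightarrow> ?T = group_elt ` carrier G"
    using bij_betw_circ unfolding bij_betw_def by (intro inj_on_image_eq_iff) auto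
  moreover have "?T = group_elt ` carrier G \<longleftrightarrow> ?T \<subseteq> group_elt ` carrier G"
    using group_elt_pow_p by auto
  moreover have "?T \<subseteq> group_elt ` carrier G \<longleftrightarrow> primitive_root_mod p 2"
    unfolding primitive_root_iff_roots_of_unity by blast
  ultimately show ?thesis by (simp only:)
qed

theorem primitive_root_iff_circulant_invertible:
  "primitive_root_mod p 2 \<longleftrightarrow>
    (\<forall>A :: bit mat. circulant p A \<and> A \<noteq> mat p p (\<lambda>_. 1) \<and> vec p (\<lambda>_. 1) \<notin> mat_kernel A
      \<longrightarrow> invertible_mat A)"
proof -
  have *: "(circ f \<noteq> mat p p (\<lambda>_. 1) \<and> vec p (\<lambda>_. 1) \<notin> mat_kernel (circ f) \<longrightarrow> invertible_mat (circ f)) \<longleftrightarrow>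
      (f \<noteq> \<nu> \<and> augmentation f \<noteq> 0 \<longrightarrow> f \<in> Units F2G)" if "f \<in> carrier F2G" for f
    using that
    by (simp only: circ_norm[symmetric] circ_eq_iff norm_element_closed all_ones_in_kernel_circ_iff invertible_circ_iff)
  show ?thesis
    unfolding primitive_root_iff_units
  proof (intro iffI allI impI ballI, elim conjE)
    fix A :: "bit mat"
    assume "\<forall>f\<in>carrier F2G. f \<noteq> \<nu> \<and> augmentation f \<noteq> 0 \<longrightarrow> f \<in> Units F2G"
      and "circulant p A" and A: "A \<noteq> mat p p (\<lambda>_. 1)" "vec p (\<lambda>_. 1) \<notin> mat_kernel A"
    moreover then obtain f where "f \<in> carrier F2G" "A = circ f" by (elim circulant_obtain)
    ultimately show "invertible_mat A" using *[of f] by blast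
  next
    fix f
    assume A: "\<forall>A :: bit mat. circulant p A \<and> A \<noteq> mat p p (\<lambda>_. 1) \<and> vec p (\<lambda>_. 1) \<notin> mat_kernel A
      \<longrightarrow> invertible_mat A"
      and f: "f \<in> carrier F2G" "f \<noteq> \<nu> \<and> augmentation f \<noteq> 0"
    show "f \<in> Units F2G"
      using A[rule_format, of "circ f"] circulant_circ[of f] *[OF f(1)] f(2) by blast
  qed
qed

text \<open>
  The degree of a circulant graph is the size of the support of its algebra element, so odd degree means
  nonzero augmentation, and the complete graph is the norm element.
\<close>

theorem primitive_root_iff_odd_degree_graphs:
  "primitive_root_mod p 2 \<longleftrightarrow>
    (\<forall>E d. circulant_graph p E \<and> regular_of_degree p E d \<and> odd d \<and> E \<noteq> complete_bigraph p
      \<longrightarrow> odd (card (perfect_matchings p E)))"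
  unfolding primitive_root_iff_units
proof (intro iffI allI impI ballI, elim conjE)
  fix E d
  assume *: "\<forall>f\<in>carrier F2G. f \<noteq> \<nu> \<and> augmentation f \<noteq> 0 \<longrightarrow> f \<in> Units F2G"
    and "circulant_graph p E" and E: "regular_of_degree p E d" "odd d" "E \<noteq> complete_bigraph p"
  then obtain f where f: "f \<in> carrier F2G" "E = circ_graph f" by (elim circulant_graph_obtain)
  have "f \<noteq> \<nu>" using E(3) circ_graph_norm f(2) by blast
  moreover have "card {x. f x \<noteq> 0} = d" using E(1) regular_circ_graph_iff[OF f(1)] unfolding f(2) by blast
  then have "augmentation f \<noteq> 0"
    using E(2) by (simp only: augmentation_eq_card[OF f(1)] of_nat_bit_eq_0_iff not_False_eq_True)
  ultimately have "f \<in> Units F2G" using * f(1) by blast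
  then show "odd (card (perfect_matchings p E))"
    unfolding f(2) odd_perfect_matchings_circ_graph_iff[OF f(1)] .
next
  fix f
  assume *: "\<forall>E d. circulant_graph p E \<and> regular_of_degree p E d \<and> odd d \<and> E \<noteq> complete_bigraph p
      \<longrightarrow> odd (card (perfect_matchings p E))"
    and f: "f \<in> carrier F2G" and ne: "f \<noteq> \<nu> \<and> augmentation f \<noteq> 0"
  have "odd (card {x. f x \<noteq> 0})"
    using ne unfolding augmentation_eq_card[OF f] of_nat_bit_eq_0_iff by blast
  moreover have "regular_of_degree p (circ_graph f) (card {x. f x \<noteq> 0})"
    unfolding regular_circ_graph_iff[OF f] ..
  moreover have "circ_graph f \<noteq> complete_bigraph p"
    using ne unfolding circ_graph_norm[symmetric] circ_graph_eq_iff[OF f norm_element_closed] by blast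
  ultimately have "odd (card (perfect_matchings p (circ_graph f)))"
    using * circulant_circ_graph[OF f] by blast
  then show "f \<in> Units F2G" unfolding odd_perfect_matchings_circ_graph_iff[OF f] .
qed

text \<open>
  The condition on pseudopaths says that the \<open>p\<close>-th power of the algebra element is the identity, and
  degree 1 says that the support is a single group element.
\<close>

theorem primitive_root_iff_pseudopaths:
  "primitive_root_mod p 2 \<longleftrightarrow>
    (\<forall>E. circulant_graph p E \<and> odd (card (perfect_matchings p E)) \<and>
       (\<forall>i<p. \<forall>j<p. pseudopath_count E p i j mod 2 = (if i = j then 1 else 0))
     \<longrightarrow> regular_of_degree p E 1)"
  unfolding primitive_root_iff_roots_of_unity
proof (intro iffI allI impI ballI)
  fix E
  assume *: "\<forall>u\<in>carrier F2G. u [^]\<^bsub>F2G\<^esub> p = \<one>\<^bsub>F2G\<^esub> \<longrightarrow> u \<in> group_elt ` carrier G"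
    and "circulant_graph p E \<and> odd (card (perfect_matchings p E)) \<and>
       (\<forall>i<p. \<forall>j<p. pseudopath_count E p i j mod 2 = (if i = j then 1 else 0))"
  then have "circulant_graph p E"
    and E: "\<forall>i<p. \<forall>j<p. pseudopath_count E p i j mod 2 = (if i = j then 1 else 0)"
    by (iprover, iprover)
  then obtain f where f: "f \<in> carrier F2G" "E = circ_graph f" by (elim circulant_graph_obtain)
  have "f [^]\<^bsub>F2G\<^esub> p = \<one>\<^bsub>F2G\<^esub>"
    using E unfolding f(2) pseudopath_count_circ_graph_iff[OF f(1)] .
  then have "f \<in> group_elt ` carrier G" using * f(1) by blast
  then show "regular_of_degree p E 1"
    unfolding f(2) regular_circ_graph_iff[OF f(1)] group_elt_iff_card_support[OF f(1)] .
next
  fix u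
  assume *: "\<forall>E. circulant_graph p E \<and> odd (card (perfect_matchings p E)) \<and>
       (\<forall>i<p. \<forall>j<p. pseudopath_count E p i j mod 2 = (if i = j then 1 else 0))
     \<longrightarrow> regular_of_degree p E 1"
    and u: "u \<in> carrier F2G" "u [^]\<^bsub>F2G\<^esub> p = \<one>\<^bsub>F2G\<^esub>"
  have "regular_of_degree p (circ_graph u) 1"
  proof (rule *[rule_format], intro conjI)
    show "circulant_graph p (circ_graph u)" by (rule circulant_circ_graph[OF u(1)])
    show "odd (card (perfect_matchings p (circ_graph u)))"
      unfolding odd_perfect_matchings_circ_graph_iff[OF u(1)] by (rule pth_root_of_unity_Units[OF u])
    show "\<forall>i<p. \<forall>j<p. pseudopath_count (circ_graph u) p i j mod 2 = (if i = j then 1 else 0)"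
      unfolding pseudopath_count_circ_graph_iff[OF u(1)] by (rule u(2))
  qed
  then show "u \<in> group_elt ` carrier G"
    unfolding regular_circ_graph_iff[OF u(1)] group_elt_iff_card_support[OF u(1)] .
qed

end

lemma all_equivalentI:
  assumes "list_all (\<lambda>S. S \<longleftrightarrow> P) Ss" and "P \<Longrightarrow> Q"
  shows "all_equivalent Ss \<and> (\<forall>S\<in>set Ss. S \<longrightarrow> Q)"
proof -
  have "S \<longleftrightarrow> P" if "S \<in> set Ss" for S using assms(1) that by (simp add: list_all_iff)
  then show ?thesis unfolding all_equivalent_def using assms(2) by blast
qed

theorem theorem1p2:
  fixes p :: nat and C :: "('g, 'm) monoid_scheme"
  assumes "prime p" and "odd p"
    and "group C" and "cyclic_group C" and "Coset.order C = p"
  shows "let Ss =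
    [ \<comment> \<open>(1)\<close>
      primitive_root_mod p 2,
      \<comment> \<open>(2)\<close>
      card (Units (F2_algebra C)) = 2 ^ (p - 1) - 1,
      \<comment> \<open>(3)\<close>
      {u \<in> Units (F2_algebra C). group.ord (units_of (F2_algebra C)) u = p}
        = group_elt ` (carrier C - {\<one>\<^bsub>C\<^esub>}),
      \<comment> \<open>(4)\<close>
      (\<forall>\<theta> \<in> carrier (F2_algebra C).
         \<theta> \<noteq> norm_element C \<and> augmentation \<theta> \<noteq> 0 \<longrightarrow> \<theta> \<in> Units (F2_algebra C)),
      \<comment> \<open>(5)\<close>
      card {A :: bit mat. circulant p A \<and> invertible_mat A} = 2 ^ (p - 1) - 1,
      \<comment> \<open>(6)\<close>
      {A :: bit mat. circulant p A \<and> invertible_mat A \<and> matrix_order p A dvd p}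
        = {A. circulant p A \<and> permutation_matrix p A},
      \<comment> \<open>(7)\<close>
      (\<forall>A :: bit mat. circulant p A \<and> A \<noteq> mat p p (\<lambda>_. 1) \<and> vec p (\<lambda>_. 1) \<notin> mat_kernel A
         \<longrightarrow> invertible_mat A),
      \<comment> \<open>(8)\<close>
      card {E. circulant_graph p E \<and> odd (card (perfect_matchings p E))} = 2 ^ (p - 1) - 1,
      \<comment> \<open>(9)\<close>
      (\<forall>E d. circulant_graph p E \<and> regular_of_degree p E d \<and> odd d \<and> E \<noteq> complete_bigraph p
         \<longrightarrow> odd (card (perfect_matchings p E))),
      \<comment> \<open>(10)\<close>
      (\<forall>E. circulant_graph p E \<and> odd (card (perfect_matchings p E)) \<and>
           (\<forall>i<p. \<forall>j<p. pseudopath_count E p i j mod 2 = (if i = j then 1 else 0))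
         \<longrightarrow> regular_of_degree p E 1) ]
    in all_equivalent Ss \<and> (\<forall>S\<in>set Ss. S \<longrightarrow> p mod 8 = 3 \<or> p mod 8 = 5)"
proof -
  interpret group C by (rule assms(3))
  interpret comm_group C by (rule cyclic_imp_abelian_group[OF assms(4)])
  have p1: "p > 1" using assms(1) by (rule prime_gt_1_nat)
  have fin: "finite (carrier C)"
    using assms(5) p1 unfolding Coset.order_def by (intro card_ge_0_finite) simp
  have "\<not> carrier C \<subseteq> {\<one>\<^bsub>C\<^esub>}"
    using card_mono[of "{\<one>\<^bsub>C\<^esub>}" "carrier C"] assms(5) p1 unfolding Coset.order_def by auto
  then obtain g where g: "g \<in> carrier C" "g \<noteq> \<one>\<^bsub>C\<^esub>" by blast
  interpret odd_prime_group C p g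
    by unfold_locales (rule fin assms g)+
  have units: "primitive_root_mod p 2 \<longleftrightarrow> (\<forall>\<theta> \<in> carrier (F2_algebra C).
      \<theta> \<noteq> norm_element C \<and> augmentation \<theta> \<noteq> 0 \<longrightarrow> \<theta> \<in> Units (F2_algebra C))"
    by (rule primitive_root_iff_units)
  show ?thesis
    unfolding Let_def
  proof (rule all_equivalentI[where P = "primitive_root_mod p 2"], unfold list.pred_inject)
    assume "primitive_root_mod p 2"
    then show "p mod 8 = 3 \<or> p mod 8 = 5" by (rule primitive_root_two_mod_8[OF assms(1,2)])
  qed (intro conjI list.pred_inject(1) refl units[symmetric]
      primitive_root_iff_card_Units[symmetric]
      primitive_root_iff_units_of_order_p[symmetric]
      primitive_root_iff_card_circulant[symmetric]
      primitive_root_iff_circulant_roots_of_unity[symmetric]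
      primitive_root_iff_circulant_invertible[symmetric]
      primitive_root_iff_card_circulant_graphs[symmetric]
      primitive_root_iff_odd_degree_graphs[symmetric]
      primitive_root_iff_pseudopaths[symmetric])
qed

end
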